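(* Let $H$ be a separable infinite-dimensional Hilbert space and let $\alpha$ be a non-principal ultrafilter on $\mathbb{N}$. Then $\mathscr{F}_\alpha(B(H))$ is non-trivial (i.e. $\mathscr{F}_\alpha(B(H))\neq\mathbb{C}$) if and only if $\alpha$ is flat.
   Context: $\mathbb{N}=\{1,2,3,\dots\}$. $B(H)$ is the algebra of bounded linear operators on the (complex) Hilbert space $H$. Ultrapower and commutant: for a unital $C^*$-algebra $A$ and a non-principal ultrafilter $\alpha$ on $\mathbb{N}$, let $\mathscr{A}_\infty=\{(x_n)\in\prod_n A:\sup_n\|x_n\|<\infty\}$ and $\mathscr{N}_\alpha=\{(x_n)\in\mathscr{A}_\infty:\lim_{n\to\alpha}\|x_n\|=0\}$. The ultrapower of $A$ with respect to $\alpha$ is the $C^*$-algebra $\mathscr{C}_\alpha(A)=\mathscr{A}_\infty/\mathscr{N}_\alpha$. $A$ is identified with the subalgebra of $\mathscr{C}_\alpha(A)$ of classes of constant sequences. The commutant of $A$ in its ultrapower is $\mathscr{F}_\alpha(A)=\{\mathbf b\in\mathscr{C}_\alpha(A):\mathbf b\mathbf a=\mathbf a\mathbf b\ \text{for all }\mathbf a\in A\}$. It is called trivial if it equals $\mathbb{C}$ (scalar multiples of the unit) and non-trivial otherwise. Flat ultrafilters: let $\mathbb{N}^{\mathbb{N}\uparrow}$ denote the set of strictly increasing functions $f:\mathbb{N}\to\mathbb{N}$. Put $f^0(1)=1$ and $f^{k+1}(1)=f(f^k(1))$. For $x=(\eta_i)\in\ell^\infty$, $f\in\mathbb{N}^{\mathbb{N}\uparrow}$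 and $k\in\mathbb{N}$ let $\omega_f^k(x)=\max\{|\eta_i-\eta_j|: f^{k-1}(1)\le i\le j<f^k(1)\}$ (equal to $0$ if there are no such $i,j$), and $\omega_f(x)=\sup_{k\in\mathbb{N}}\omega_f^k(x)$. A flatness scale for $\alpha$ is a sequence $(s_n)_{n\in\mathbb{N}}$ in $[0,1]^{\mathbb{N}}$ such that (i) there exists $r>0$ with $\sup_i s_n(i)\ge r$ and $\lim_{i\to\infty}s_n(i)=0$ for every $n\in\mathbb{N}$, and (ii) $\lim_{n\to\alpha}\omega_f(s_n)=0$ for every $f\in\mathbb{N}^{\mathbb{N}\uparrow}$. The non-principal ultrafilter $\alpha$ is flat if it admits a flatness scale. *)

theory Defs
  imports "HOL-Analysis.Analysis" "HOL-Algebra.QuotRing" "HOL-Algebra.Module"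
begin

section \<open>Complex Hilbert spaces and their bounded operators\<close>

class chilbert_space = banach +
  fixes scaleC :: "complex \<Rightarrow> 'a \<Rightarrow> 'a"  (infixr \<open>*\<^sub>C\<close> 75)
    and cinner :: "'a \<Rightarrow> 'a \<Rightarrow> complex"
  assumes scaleC_add_right: "c *\<^sub>C (x + y) = c *\<^sub>C x + c *\<^sub>C y"
    and scaleC_add_left: "(c + d) *\<^sub>C x = c *\<^sub>C x + d *\<^sub>C x"
    and scaleC_scaleC: "c *\<^sub>C (d *\<^sub>C x) = (c * d) *\<^sub>C x"
    and scaleC_one: "1 *\<^sub>C x = x"
    and scaleR_scaleC: "r *\<^sub>R x = complex_of_real r *\<^sub>C x"
    and cinner_commute: "cinner x y = cnj (cinner y x)"
    and cinner_add_left: "cinner (x + y) z = cinner x z + cinner y z"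
    and cinner_scaleC_left: "cinner (c *\<^sub>C x) y = c * cinner x y"
    and cinner_ge_zero: "0 \<le> Re (cinner x x)"
    and norm_eq_sqrt_cinner: "norm x = sqrt (Re (cinner x x))"

global_interpretation complex_vector: vector_space "scaleC :: complex \<Rightarrow> 'a \<Rightarrow> 'a::chilbert_space"
  defines cspan = complex_vector.span
  by unfold_locales (simp_all add: scaleC_add_right scaleC_add_left scaleC_scaleC scaleC_one)

lemma norm_scaleC: "norm (c *\<^sub>C x) = cmod c * norm (x :: 'a::chilbert_space)"
proof -
  have r: "cinner x (c *\<^sub>C x) = cnj c * cinner x x"
    by (metis cinner_commute cinner_scaleC_left complex_cnj_mult)
  have "cinner (c *\<^sub>C x) (c *\<^sub>C x) = complex_of_real ((cmod c)\<^sup>2) * cinner x x"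
    by (simp add: cinner_scaleC_left r complex_norm_square mult.assoc[symmetric] del: of_real_power)
  then have "Re (cinner (c *\<^sub>C x) (c *\<^sub>C x)) = (cmod c)\<^sup>2 * Re (cinner x x)"
    by (simp del: of_real_power)
  then show ?thesis
    by (simp add: norm_eq_sqrt_cinner real_sqrt_mult)
qed

lemma bounded_linear_scaleC: "bounded_linear (\<lambda>x :: 'a::chilbert_space. c *\<^sub>C x)"
  by (rule bounded_linear_intro[of _ "cmod c"])
    (simp_all add: scaleC_add_right scaleR_scaleC scaleC_scaleC mult.commute norm_scaleC)

lift_definition scaleC_blinfun ::
  "complex \<Rightarrow> ('a::real_normed_vector \<Rightarrow>\<^sub>L 'b::chilbert_space) \<Rightarrow> ('a \<Rightarrow>\<^sub>L 'b)"
  is "\<lambda>c T x. c *\<^sub>C T x"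
  by (rule bounded_linear_compose[OF bounded_linear_scaleC])

text \<open>The type \<open>'h \<Rightarrow>\<^sub>L 'h\<close> consists of the bounded real-linear operators with the operator norm,
  so complex linearity is imposed on the carrier.\<close>

definition bounded_operators :: "(complex, 'h::chilbert_space \<Rightarrow>\<^sub>L 'h) module" where
  "bounded_operators =
    \<lparr>carrier = {T. \<forall>c x. blinfun_apply T (c *\<^sub>C x) = c *\<^sub>C blinfun_apply T x},
     mult = (o\<^sub>L), one = id_blinfun, zero = 0, add = (+), smult = scaleC_blinfun\<rparr>"


lemma ring_bounded_operators: "ring (bounded_operators :: (complex, 'h::chilbert_space \<Rightarrow>\<^sub>L 'h) module)"
proof (rule ringI)
  show "abelian_group (bounded_operators :: (complex, 'h \<Rightarrow>\<^sub>L 'h) module)"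
  proof (rule abelian_groupI)
    fix T :: "'h \<Rightarrow>\<^sub>L 'h" assume T: "T \<in> carrier bounded_operators"
    have "- T \<in> carrier bounded_operators"
      using T by (simp add: bounded_operators_def blinfun.minus_left complex_vector.scale_minus_right)
    then show "\<exists>S\<in>carrier bounded_operators. S \<oplus>\<^bsub>bounded_operators\<^esub> T = \<zero>\<^bsub>bounded_operators\<^esub>"
      by (rule rev_bexI) (simp add: bounded_operators_def)
  qed (simp_all add: bounded_operators_def blinfun.add_left scaleC_add_right add.assoc add.commute)
  show "Group.monoid (bounded_operators :: (complex, 'h \<Rightarrow>\<^sub>L 'h) module)"
    by (rule monoidI) (simp_all add: bounded_operators_def blinfun_apply_inject[symmetric] fun_eq_iff)
qed (simp_all add: bounded_operators_def blinfun_apply_inject[symmetric] fun_eq_iff blinfun.add_left blinfun.add_right)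


section \<open>Ultrapowers and relative commutants\<close>

definition nonprincipal_ultrafilter :: "'a filter \<Rightarrow> bool" where
  "nonprincipal_ultrafilter \<alpha> \<longleftrightarrow>
    \<alpha> \<noteq> bot \<and>
    (\<forall>P. eventually P \<alpha> \<or> eventually (\<lambda>n. \<not> P n) \<alpha>) \<and>
    (\<forall>m. \<not> eventually (\<lambda>n. n = m) \<alpha>)"

text \<open>In the following, the algebraic operations of \<open>A\<close> are those of the record, and its norm
  is the norm of the underlying type.\<close>

definition bounded_seq_ring ::
  "('b::real_normed_vector, 'm) ring_scheme \<Rightarrow> (nat \<Rightarrow> 'b) ring" where
  "bounded_seq_ring A =
    \<lparr>carrier = {x. range x \<subseteq> carrier A \<and> bounded (range x)},
     mult = (\<lambda>x y n. x n \<otimes>\<^bsub>A\<^esub> y n), one = (\<lambda>n. \<one>\<^bsub>A\<^esub>),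
     zero = (\<lambda>n. \<zero>\<^bsub>A\<^esub>), add = (\<lambda>x y n. x n \<oplus>\<^bsub>A\<^esub> y n)\<rparr>"

definition null_seqs ::
  "nat filter \<Rightarrow> ('b::real_normed_vector, 'm) ring_scheme \<Rightarrow> (nat \<Rightarrow> 'b) set" where
  "null_seqs \<alpha> A = {x \<in> carrier (bounded_seq_ring A). ((\<lambda>n. norm (x n)) \<longlongrightarrow> 0) \<alpha>}"

lemma ideal_null_seqs:
  "ideal (null_seqs \<alpha> (bounded_operators :: (complex, 'h::chilbert_space \<Rightarrow>\<^sub>L 'h) module))
     (bounded_seq_ring bounded_operators)"
proof -
  let ?B = "bounded_operators :: (complex, 'h \<Rightarrow>\<^sub>L 'h) module"
  let ?R = "bounded_seq_ring ?B"
  interpret B: ring ?B by (rule ring_bounded_operators)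
  have B_simps: "\<one>\<^bsub>?B\<^esub> = id_blinfun" "\<zero>\<^bsub>?B\<^esub> = 0" "x \<oplus>\<^bsub>?B\<^esub> y = x + y" "x \<otimes>\<^bsub>?B\<^esub> y = x o\<^sub>L y" for x y
    by (simp_all add: bounded_operators_def)
  have bd: "bounded (range x) \<longleftrightarrow> (\<exists>K. \<forall>n. norm (x n) \<le> K)" for x :: "nat \<Rightarrow> 'h \<Rightarrow>\<^sub>L 'h"
    by (auto simp: bounded_iff)
  have car: "x \<in> carrier ?R \<longleftrightarrow> (\<forall>n. x n \<in> carrier ?B) \<and> (\<exists>K. \<forall>n. norm (x n) \<le> K)" for x
    by (auto simp: bounded_seq_ring_def bd)
  have ops: "\<one>\<^bsub>?R\<^esub> = (\<lambda>n. id_blinfun)" "\<zero>\<^bsub>?R\<^esub> = (\<lambda>n. 0)" "x \<oplus>\<^bsub>?R\<^esub> y = (\<lambda>n. x n + y n)"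
    "x \<otimes>\<^bsub>?R\<^esub> y = (\<lambda>n. x n o\<^sub>L y n)" for x y
    by (simp_all add: bounded_seq_ring_def B_simps)
  have neg: "- T \<in> carrier ?B" if "T \<in> carrier ?B" for T
  proof -
    have "T + (\<ominus>\<^bsub>?B\<^esub> T) = 0" using B.r_neg[OF that] by (simp add: B_simps)
    then have "- T = \<ominus>\<^bsub>?B\<^esub> T" by (simp add: minus_unique)
    then show ?thesis using that by simp
  qed
  have add_cl: "x \<oplus>\<^bsub>?R\<^esub> y \<in> carrier ?R" if "x \<in> carrier ?R" "y \<in> carrier ?R" for x y
  proof -
    from that obtain K L where "\<And>n. norm (x n) \<le> K" "\<And>n. norm (y n) \<le> L" by (auto simp: car)
    then have "norm (x n + y n) \<le> K + L" for n by (meson norm_triangle_mono)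
    then show ?thesis using that B.a_closed by (auto simp: car ops B_simps)
  qed
  have mult_cl: "x \<otimes>\<^bsub>?R\<^esub> y \<in> carrier ?R" if "x \<in> carrier ?R" "y \<in> carrier ?R" for x y
  proof -
    from that obtain K L where "\<And>n. norm (x n) \<le> K" "\<And>n. norm (y n) \<le> L" by (auto simp: car)
    then have "norm (x n o\<^sub>L y n) \<le> K * L" for n
      by (meson mult_mono norm_blinfun_compose norm_ge_zero order_trans)
    then show ?thesis using that B.m_closed by (auto simp: car ops B_simps)
  qed
  have neg_cl: "(\<lambda>n. - x n) \<in> carrier ?R" if "x \<in> carrier ?R" for x
    using that neg by (auto simp: car)
  have id_cl: "(\<lambda>n. id_blinfun) \<in> carrier ?R"
    using B.one_closed by (auto simp: car B_simps)
  have z_cl: "(\<lambda>n. 0) \<in> carrier ?R"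
    using B.zero_closed by (auto simp: car B_simps)
  have R: "ring ?R"
  proof (rule ringI)
    show "abelian_group ?R"
    proof (rule abelian_groupI)
      fix x assume x: "x \<in> carrier ?R"
      show "\<exists>y\<in>carrier ?R. y \<oplus>\<^bsub>?R\<^esub> x = \<zero>\<^bsub>?R\<^esub>"
        by (rule bexI[OF _ neg_cl[OF x]]) (simp add: ops)
    qed (use add_cl z_cl in \<open>auto simp: ops algebra_simps\<close>)
    show "Group.monoid ?R"
      by (rule monoidI) (use mult_cl id_cl in \<open>simp_all add: ops fun_eq_iff blinfun_apply_inject[symmetric]\<close>)
  qed (simp_all add: ops fun_eq_iff blinfun_apply_inject[symmetric] blinfun.add_left blinfun.add_right)
  interpret R: ring ?R by (rule R)
  have nul: "x \<in> null_seqs \<alpha> ?B \<longleftrightarrow> x \<in> carrier ?R \<and> ((\<lambda>n. norm (x n)) \<longlongrightarrow> 0) \<alpha>" for x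
    by (simp add: null_seqs_def)
  show ?thesis
  proof (rule idealI[OF R])
    have inv: "inv\<^bsub>add_monoid ?R\<^esub> x = (\<lambda>n. - x n)" if "x \<in> carrier ?R" for x
      using R.minus_equality[OF _ that neg_cl[OF that]] by (simp add: ops a_inv_def)
    show "subgroup (null_seqs \<alpha> ?B) (add_monoid ?R)"
    proof (rule subgroup.intro)
      fix x y assume "x \<in> null_seqs \<alpha> ?B" "y \<in> null_seqs \<alpha> ?B"
      then have "x \<oplus>\<^bsub>?R\<^esub> y \<in> null_seqs \<alpha> ?B" 
        using add_cl tendsto_add[of x 0 \<alpha> y 0] by (auto simp: nul ops tendsto_norm_zero_iff)
      then show "x \<otimes>\<^bsub>add_monoid ?R\<^esub> y \<in> null_seqs \<alpha> ?B" by simp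
    qed (use inv neg_cl z_cl in \<open>auto simp: nul ops\<close>)
  next
    fix a x assume a: "a \<in> null_seqs \<alpha> ?B" and x: "x \<in> carrier ?R"
    then obtain K where K: "\<And>n. norm (x n) \<le> K" by (auto simp: car)
    have lim: "((\<lambda>n. norm (a n) * K) \<longlongrightarrow> 0) \<alpha>"
      using a by (auto simp: nul intro: tendsto_mult_left_zero)
    have aK: "norm (a n) * norm (x n) \<le> norm (a n) * K" for n
      by (rule mult_left_mono[OF K norm_ge_zero])
    have xa: "norm (x n o\<^sub>L a n) \<le> norm (a n) * K" for n
      using norm_blinfun_compose[of "x n" "a n"] aK[of n]
      by (subst (asm) mult.commute) (rule order_trans)
    have ax: "norm (a n o\<^sub>L x n) \<le> norm (a n) * K" for n
      using norm_blinfun_compose[of "a n" "x n"] aK[of n] by (rule order_trans)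
    have "((\<lambda>n. norm (x n o\<^sub>L a n)) \<longlongrightarrow> 0) \<alpha>"
      by (rule tendsto_sandwich[OF _ _ tendsto_const lim]) (simp_all add: xa)
    moreover have "((\<lambda>n. norm (a n o\<^sub>L x n)) \<longlongrightarrow> 0) \<alpha>"
      by (rule tendsto_sandwich[OF _ _ tendsto_const lim]) (simp_all add: ax)
    moreover have "a \<in> carrier ?R" using a unfolding nul by blast
    ultimately show "x \<otimes>\<^bsub>?R\<^esub> a \<in> null_seqs \<alpha> ?B" "a \<otimes>\<^bsub>?R\<^esub> x \<in> null_seqs \<alpha> ?B"
      using mult_cl[OF x, of a] mult_cl[OF _ x, of a] unfolding nul ops by blast+
  qed
qed

text \<open>Hence the quotient below is a ring for \<open>A = bounded_operators\<close>.\<close>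

definition ultrapower ::
  "nat filter \<Rightarrow> ('b::real_normed_vector, 'm) ring_scheme \<Rightarrow> (nat \<Rightarrow> 'b) set ring" where
  "ultrapower \<alpha> A = bounded_seq_ring A Quot null_seqs \<alpha> A"

definition ultrapower_const ::
  "nat filter \<Rightarrow> ('b::real_normed_vector, 'm) ring_scheme \<Rightarrow> 'b \<Rightarrow> (nat \<Rightarrow> 'b) set" where
  "ultrapower_const \<alpha> A a = null_seqs \<alpha> A +>\<^bsub>bounded_seq_ring A\<^esub> (\<lambda>n. a)"

definition ultrapower_commutant ::
  "nat filter \<Rightarrow> ('b::real_normed_vector, 'm) ring_scheme \<Rightarrow> (nat \<Rightarrow> 'b) set set" where
  "ultrapower_commutant \<alpha> A =
    {b \<in> carrier (ultrapower \<alpha> A). \<forall>a\<in>carrier A.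
      b \<otimes>\<^bsub>ultrapower \<alpha> A\<^esub> ultrapower_const \<alpha> A a =
      ultrapower_const \<alpha> A a \<otimes>\<^bsub>ultrapower \<alpha> A\<^esub> b}"

definition ultrapower_scalars ::
  "nat filter \<Rightarrow> (complex, 'b::real_normed_vector, 'm) module_scheme \<Rightarrow> (nat \<Rightarrow> 'b) set set" where
  "ultrapower_scalars \<alpha> A = range (\<lambda>c. ultrapower_const \<alpha> A (c \<odot>\<^bsub>A\<^esub> \<one>\<^bsub>A\<^esub>))"


section \<open>Flat ultrafilters\<close>

text \<open>The set \<open>{1, 2, 3, \<dots>}\<close> of the source is relabelled as \<open>nat\<close> by \<open>n \<mapsto> n - 1\<close>. Thus the
  iterates of \<open>f\<close> start at \<open>0\<close>, and the block with number \<open>k \<ge> 1\<close> becomes the block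
  \<open>f\<^sup>k(0) \<le> i < f\<^sup>k\<^sup>+\<^sup>1(0)\<close> with number \<open>k \<ge> 0\<close>.\<close>

definition block_oscillation :: "(nat \<Rightarrow> nat) \<Rightarrow> nat \<Rightarrow> (nat \<Rightarrow> real) \<Rightarrow> real" where
  "block_oscillation f k x =
    Max (insert 0 {\<bar>x i - x j\<bar> | i j. (f ^^ k) 0 \<le> i \<and> i \<le> j \<and> j < (f ^^ Suc k) 0})"

definition oscillation :: "(nat \<Rightarrow> nat) \<Rightarrow> (nat \<Rightarrow> real) \<Rightarrow> real" where
  "oscillation f x = (SUP k. block_oscillation f k x)"

definition flatness_scale :: "nat filter \<Rightarrow> (nat \<Rightarrow> nat \<Rightarrow> real) \<Rightarrow> bool" where
  "flatness_scale \<alpha> s \<longleftrightarrow>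
    (\<forall>n i. s n i \<in> {0..1}) \<and>
    (\<exists>r>0. \<forall>n. (SUP i. s n i) \<ge> r \<and> s n \<longlonglongrightarrow> 0) \<and>
    (\<forall>f. strict_mono f \<longrightarrow> ((\<lambda>n. oscillation f (s n)) \<longlongrightarrow> 0) \<alpha>)"

definition flat :: "nat filter \<Rightarrow> bool" where
  "flat \<alpha> \<longleftrightarrow> (\<exists>s. flatness_scale \<alpha> s)"

end

theory Submission
  imports Defs
begin

text \<open>Fix an orthonormal basis. A sequence \<open>s\<^sub>n\<close> of slowly varying null sequences gives diagonal
  operators that asymptotically commute with each bounded \<open>a\<close>: for a partition of the basis into
  rapidly growing blocks, \<open>a\<close> is block tridiagonal up to a small error, and \<open>s\<^sub>n\<close> is almost constant
  on adjacent blocks.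

  Conversely, let \<open>(b\<^sub>n)\<close> asymptotically commute with every operator, and let \<open>w\<^sub>n(i)\<close> be the diameter
  of the numerical range of \<open>b\<^sub>n\<close> compressed to the span of the basis vectors from index \<open>i\<close> on. This is
  decreasing in \<open>i\<close>. Commuting with the isometry that shifts the basis along \<open>f\<close> gives
  \<open>w\<^sub>n(i) - w\<^sub>n(f(i)) \<rightarrow> 0\<close> uniformly in \<open>i\<close>; commuting with a single partial isometry that matches suitable
  far out vectors for all \<open>n\<close> at once gives \<open>lim\<^sub>i w\<^sub>n(i) \<rightarrow> 0\<close> along \<open>\<alpha>\<close>; and \<open>w\<^sub>n(0) \<rightarrow> 0\<close> would make
  \<open>(b\<^sub>n)\<close> scalar by polarization. So \<open>w\<^sub>n - lim\<^sub>i w\<^sub>n(i)\<close> is a flatness scale up to normalization.\<close>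

section \<open>The inner product\<close>

text \<open>Commutation is assumed for one operator at a time, and its rate along \<alpha> may
  depend on that operator. Every estimate that has to be uniform, over the tails or over the members
  of the sequence, is therefore packed into one test operator. Monotonicity of the spread is what
  makes this enough: two indices i \<le> j in one block of f satisfy j \<le> f i, so the drop from i
  to f i controls the whole block. The conditions on supremum and limit of a flatness scale concern
  every n, while the estimates hold only on a set in \<alpha>. Hence the limit spread is subtracted
  exactly, and the remaining n receive a fixed default sequence.

  In the other direction the blocks may depend on the operator and on the tolerance, but not on n,
  or flatness could not be applied to them. Flatness controls \<open>s n\<close> inside one block
  only, whereas a bounded operator also couples neighbouring blocks. Windows of two adjacent blocks
  are therefore realised as the blocks of two further increasing functions, one for windows starting
  at an even position and one for odd positions.\<close>

lemma cinner_add_right: "cinner x (y + z) = cinner x y + cinner x (z :: 'a::chilbert_space)"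
  by (metis cinner_commute cinner_add_left complex_cnj_add)

lemma cinner_scaleC_right: "cinner x (c *\<^sub>C y) = cnj c * cinner x (y :: 'a::chilbert_space)"
  by (metis cinner_commute cinner_scaleC_left complex_cnj_mult)

lemma cinner_self: "cinner x x = complex_of_real ((norm (x :: 'a::chilbert_space))\<^sup>2)"
proof -
  have "cinner x x \<in> \<real>"
    using cinner_commute[of x x] by (metis Reals_cnj_iff)
  then show ?thesis
    by (simp add: norm_eq_sqrt_cinner cinner_ge_zero complex_is_Real_iff complex_eq_iff)
qed

lemma cinner_zero_left [simp]: "cinner 0 (y :: 'a::chilbert_space) = 0"
  using cinner_scaleC_left[of 0 0 y] by simp

lemma cinner_zero_right [simp]: "cinner (y :: 'a::chilbert_space) 0 = 0"
  using cinner_scaleC_right[of y 0 0] by simp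

lemma cinner_diff_left: "cinner (x - y) z = cinner x z - cinner y (z :: 'a::chilbert_space)"
  using cinner_add_left[of "x - y" y z] by simp

lemma cinner_diff_right: "cinner x (y - z) = cinner x y - cinner x (z :: 'a::chilbert_space)"
  using cinner_add_right[of x "y - z" z] by simp

lemma Cauchy_Schwarz_cinner: "cmod (cinner x y) \<le> norm x * norm (y :: 'a::chilbert_space)"
proof (cases "y = 0")
  case False
  define c where "c = cinner x y / complex_of_real ((norm y)\<^sup>2)"
  define z where "z = x - c *\<^sub>C y"
  have ny: "norm y \<noteq> 0"
    using False by simp
  have "cinner z y = 0"
    using ny by (simp add: z_def cinner_diff_left cinner_scaleC_left cinner_self c_def)
  then have "cinner z z = cinner z x"
    by (subst (2) z_def) (simp add: cinner_diff_right cinner_scaleC_right)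
  also have "\<dots> = complex_of_real ((norm x)\<^sup>2) - c * cinner y x"
    by (simp add: z_def cinner_diff_left cinner_scaleC_left cinner_self)
  also have "c * cinner y x = complex_of_real ((cmod (cinner x y))\<^sup>2 / (norm y)\<^sup>2)"
    using complex_norm_square[of "cinner x y"] by (simp add: c_def cinner_commute[of y x])
  finally have "complex_of_real ((norm z)\<^sup>2) =
      complex_of_real ((norm x)\<^sup>2 - (cmod (cinner x y))\<^sup>2 / (norm y)\<^sup>2)"
    by (simp only: cinner_self of_real_diff)
  then have "(norm z)\<^sup>2 = (norm x)\<^sup>2 - (cmod (cinner x y))\<^sup>2 / (norm y)\<^sup>2"
    by (simp only: of_real_eq_iff)
  then have "(cmod (cinner x y))\<^sup>2 / (norm y)\<^sup>2 \<le> (norm x)\<^sup>2"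
    by (smt (verit) zero_le_power2)
  then have "(cmod (cinner x y))\<^sup>2 \<le> (norm x * norm y)\<^sup>2"
    using ny by (simp add: divide_simps power_mult_distrib)
  then show ?thesis
    by (rule power2_le_imp_le) simp
qed simp

lemma bounded_bilinear_cinner: "bounded_bilinear (cinner :: 'a::chilbert_space \<Rightarrow> 'a \<Rightarrow> complex)"
proof
  show "\<exists>K. \<forall>x y :: 'a. norm (cinner x y) \<le> norm x * norm y * K"
    by (rule exI[of _ 1]) (simp add: Cauchy_Schwarz_cinner)
qed (simp_all add: cinner_add_left cinner_add_right scaleR_scaleC cinner_scaleC_left
    cinner_scaleC_right scaleR_conv_of_real)

interpretation cinner: bounded_bilinear "cinner :: 'a::chilbert_space \<Rightarrow> 'a \<Rightarrow> complex"
  by (rule bounded_bilinear_cinner)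

lemma norm_add_square_orthogonal:
  assumes "cinner x y = 0"
  shows "(norm (x + y :: 'a::chilbert_space))\<^sup>2 = (norm x)\<^sup>2 + (norm y)\<^sup>2"
proof -
  have "cinner y x = 0"
    using assms cinner_commute[of y x] by simp
  then have "complex_of_real ((norm (x + y))\<^sup>2) = complex_of_real ((norm x)\<^sup>2 + (norm y)\<^sup>2)"
    using assms by (simp only: cinner_self[symmetric] of_real_add cinner_add_left cinner_add_right)
      simp
  then show ?thesis
    by (simp only: of_real_eq_iff)
qed

lemma norm_sum_square_orthogonal:
  fixes v :: "'i \<Rightarrow> 'a::chilbert_space"
  assumes "finite A" "\<And>i j. i \<in> A \<Longrightarrow> j \<in> A \<Longrightarrow> i \<noteq> j \<Longrightarrow> cinner (v i) (v j) = 0"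
  shows "(norm (sum v A))\<^sup>2 = (\<Sum>i\<in>A. (norm (v i))\<^sup>2)"
  using assms
proof (induction A)
  case (insert a A)
  have "cinner (v a) (sum v A) = (\<Sum>j\<in>A. cinner (v a) (v j))"
    by (rule cinner.sum_right)
  also have "\<dots> = 0"
    using insert by (intro sum.neutral) auto
  finally show ?case
    using insert norm_add_square_orthogonal[of "v a" "sum v A"] by simp
qed simp

lemma cspan_orthogonal:
  assumes "x \<in> cspan S" "\<And>s. s \<in> S \<Longrightarrow> cinner s y = 0"
  shows "cinner x (y :: 'a::chilbert_space) = 0"
  using assms(1)
  by (induction rule: complex_vector.span_induct_alt)
    (simp_all add: cinner_add_left cinner_scaleC_left assms(2))

section \<open>Operator norms from sesquilinear and quadratic forms\<close>

definition clinear :: "('a::chilbert_space \<Rightarrow>\<^sub>L 'a) \<Rightarrow> bool" where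
  "clinear T \<longleftrightarrow> (\<forall>c x. T (c *\<^sub>C x) = c *\<^sub>C T x)"

text \<open>Both sides are continuous in each variable, so the bound passes from D to the whole
  space one variable at a time. Testing with \<open>y = T x\<close> then bounds the norm.\<close>

lemma norm_cinner_bound_extend:
  fixes T :: "'a::chilbert_space \<Rightarrow>\<^sub>L 'a"
  assumes D: "closure D = UNIV" and M: "0 \<le> M"
    and b: "\<And>x y. x \<in> D \<Longrightarrow> y \<in> D \<Longrightarrow> cmod (cinner (T x) y) \<le> M * norm x * norm y"
  shows "norm T \<le> M"
proof -
  have c2: "cmod (cinner (T x) y) \<le> M * norm x * norm y" if x: "x \<in> D" for x y
  proof -
    have "closed {y. cmod (cinner (T x) y) \<le> M * norm x * norm y}"
      by (intro closed_Collect_le continuous_intros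
          bounded_linear.continuous_on[OF cinner.bounded_linear_right])
    then have "closure D \<subseteq> {y. cmod (cinner (T x) y) \<le> M * norm x * norm y}"
      using b[OF x] by (intro closure_minimal) auto
    then show ?thesis
      using D by auto
  qed
  have c1: "cmod (cinner (T x) y) \<le> M * norm x * norm y" for x y
  proof -
    have "closed {x. cmod (cinner (T x) y) \<le> M * norm x * norm y}"
      by (intro closed_Collect_le continuous_intros
          bounded_linear.continuous_on[OF cinner.bounded_linear_left])
    then have "closure D \<subseteq> {x. cmod (cinner (T x) y) \<le> M * norm x * norm y}"
      using c2 by (intro closure_minimal) auto
    then show ?thesis
      using D by auto
  qed
  show ?thesis
  proof (rule norm_blinfun_bound[OF M])
    fix x
    have "norm (T x) * norm (T x) \<le> M * norm x * norm (T x)"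
      using c1[of x "T x"] by (simp add: cinner_self power2_eq_square norm_mult)
    then show "norm (T x) \<le> M * norm x"
      by (cases "T x = 0") (simp_all add: M)
  qed
qed

lemma norm_cinner_bound_unit:
  fixes T :: "'a::chilbert_space \<Rightarrow>\<^sub>L 'a"
  assumes T: "clinear T" and D: "closure D = UNIV" "complex_vector.subspace D" and M: "0 \<le> M"
    and b: "\<And>x y. x \<in> D \<Longrightarrow> y \<in> D \<Longrightarrow> norm x \<le> 1 \<Longrightarrow> norm y \<le> 1 \<Longrightarrow> cmod (cinner (T x) y) \<le> M"
  shows "norm T \<le> M"
proof (rule norm_cinner_bound_extend[OF D(1) M])
  fix x y assume xy: "x \<in> D" "y \<in> D"
  show "cmod (cinner (T x) y) \<le> M * norm x * norm y"
  proof (cases "x = 0 \<or> y = 0")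
    case False
    define u where "u = complex_of_real (1 / norm x) *\<^sub>C x"
    define v where "v = complex_of_real (1 / norm y) *\<^sub>C y"
    have uv: "u \<in> D" "v \<in> D" "norm u \<le> 1" "norm v \<le> 1"
      using xy False D(2)
      by (auto simp: u_def v_def norm_scaleC norm_divide complex_vector.subspace_scale)
    have "cinner (T u) v = cinner (T x) y / complex_of_real (norm x * norm y)"
      using T by (simp add: u_def v_def clinear_def cinner_scaleC_left cinner_scaleC_right)
    then have "cmod (cinner (T x) y) / (norm x * norm y) \<le> M"
      using b[OF uv] by (simp add: norm_divide norm_mult)
    then show ?thesis
      using False by (simp add: divide_simps split: if_splits)
  qed (auto simp: blinfun.zero_right)
qed

lemma polarization:
  fixes T :: "'a::chilbert_space \<Rightarrow>\<^sub>L 'a"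
  assumes "clinear T"
  shows "4 * cinner (T x) y =
    cinner (T (x + y)) (x + y) - cinner (T (x + (-1) *\<^sub>C y)) (x + (-1) *\<^sub>C y)
    + \<i> * cinner (T (x + \<i> *\<^sub>C y)) (x + \<i> *\<^sub>C y)
    - \<i> * cinner (T (x + (- \<i>) *\<^sub>C y)) (x + (- \<i>) *\<^sub>C y)"
proof -
  have l: "T (c *\<^sub>C z) = c *\<^sub>C T z" for c z
    using assms by (simp add: clinear_def)
  show ?thesis
    by (simp add: blinfun.add_right l cinner_add_left cinner_add_right cinner_scaleC_left
        cinner_scaleC_right algebra_simps del: complex_vector.scale_minus_left)
qed

text \<open>Polarization expresses 4 \<open>cinner (T x) y\<close> by four values of the quadratic
  form at vectors of norm at most 2, each at most 4 M. Testing on a dense subspace matters because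
  the spread sees only finite combinations of basis vectors.\<close>

lemma norm_le_numerical_radius:
  fixes T :: "'a::chilbert_space \<Rightarrow>\<^sub>L 'a"
  assumes T: "clinear T" and D: "closure D = UNIV" "complex_vector.subspace D" and M: "0 \<le> M"
    and b: "\<And>x. x \<in> D \<Longrightarrow> norm x = 1 \<Longrightarrow> cmod (cinner (T x) x) \<le> M"
  shows "norm T \<le> 4 * M"
proof (rule norm_cinner_bound_unit[OF T D])
  have l: "T (c *\<^sub>C z) = c *\<^sub>C T z" for c z
    using T by (simp add: clinear_def)
  have b': "cmod (cinner (T x) x) \<le> M * (norm x)\<^sup>2" if x: "x \<in> D" for x
  proof (cases "x = 0")
    case False
    define u where "u = complex_of_real (1 / norm x) *\<^sub>C x"
    have u: "u \<in> D" "norm u = 1"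
      using x False D(2) by (auto simp: u_def norm_scaleC norm_divide complex_vector.subspace_scale)
    have "x = complex_of_real (norm x) *\<^sub>C u"
      using False by (simp add: u_def scaleC_scaleC)
    then have "cinner (T x) x = complex_of_real ((norm x)\<^sup>2) * cinner (T u) u"
      by (metis (no_types) l cinner_scaleC_left cinner_scaleC_right complex_cnj_complex_of_real mult.assoc
          of_real_mult power2_eq_square)
    then have "cmod (cinner (T x) x) = (norm x)\<^sup>2 * cmod (cinner (T u) u)"
      by (simp add: norm_mult norm_power)
    then show ?thesis
      using mult_left_mono[OF b[OF u], of "(norm x)\<^sup>2"] by (simp add: mult.commute)
  qed (simp add: M)
  fix x y assume xy: "x \<in> D" "y \<in> D" "norm x \<le> 1" "norm y \<le> 1"
  have q: "cmod (cinner (T (x + c *\<^sub>C y)) (x + c *\<^sub>C y)) \<le> 4 * M" if c: "cmod c = 1" for c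
  proof -
    have mem: "x + c *\<^sub>C y \<in> D"
      using xy D(2) by (auto intro: complex_vector.subspace_add complex_vector.subspace_scale)
    have "norm (x + c *\<^sub>C y) \<le> 1 + 1"
      using xy c by (intro norm_triangle_mono) (auto simp: norm_scaleC)
    then have "(norm (x + c *\<^sub>C y))\<^sup>2 \<le> 2\<^sup>2"
      by (intro power_mono) auto
    then have "M * (norm (x + c *\<^sub>C y))\<^sup>2 \<le> M * 4"
      using M by (intro mult_left_mono) auto
    then show ?thesis
      using b'[OF mem] by linarith
  qed
  let ?q = "\<lambda>c. cinner (T (x + c *\<^sub>C y)) (x + c *\<^sub>C y)"
  have "4 * cmod (cinner (T x) y) = cmod (4 * cinner (T x) y)"
    by (simp add: norm_mult)
  also have "\<dots> = cmod (?q 1 - ?q (-1) + \<i> * ?q \<i> - \<i> * ?q (- \<i>))"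
    using polarization[OF T, of x y] by (simp only: scaleC_one)
  also have "\<dots> \<le> cmod (?q 1) + cmod (?q (-1)) + cmod (\<i> * ?q \<i>) + cmod (\<i> * ?q (- \<i>))"
    by (meson add_mono norm_triangle_ineq norm_triangle_ineq4 order_refl order_trans)
  also have "\<dots> \<le> 4 * M + 4 * M + 4 * M + 4 * M"
    unfolding norm_mult norm_ii mult_1_left by (intro add_mono q) auto
  finally show "cmod (cinner (T x) y) \<le> 4 * M"
    by simp
qed (use M in simp)

section \<open>Orthonormal sequences\<close>

definition orthonormal :: "(nat \<Rightarrow> 'a::chilbert_space) \<Rightarrow> bool" where
  "orthonormal e \<longleftrightarrow> (\<forall>i j. cinner (e i) (e j) = (if i = j then 1 else 0))"

lemma orthonormalI:
  assumes "\<And>i. norm (e i) = 1" "\<And>i j. i < j \<Longrightarrow> cinner (e j) (e i) = 0"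
  shows "orthonormal e"
  unfolding orthonormal_def
proof (intro allI)
  fix i j
  show "cinner (e i) (e j) = (if i = j then 1 else 0)"
    using assms(2)[of i j] assms(2)[of j i] cinner_commute[of "e i" "e j"]
    by (cases i j rule: linorder_cases) (simp_all add: cinner_self assms(1))
qed

lemma orthonormal_cinner: "orthonormal e \<Longrightarrow> cinner (e i) (e j) = (if i = j then 1 else 0)"
  by (simp add: orthonormal_def)

lemma orthonormal_norm: "orthonormal e \<Longrightarrow> norm (e i) = 1"
  by (simp add: orthonormal_def norm_eq_sqrt_cinner)

lemma orthonormal_comp: "orthonormal e \<Longrightarrow> inj f \<Longrightarrow> orthonormal (\<lambda>i. e (f i))"
  by (simp add: orthonormal_def inj_eq)

lemma orthonormal_norm_sum:
  assumes "orthonormal e" "finite A"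
  shows "(norm (\<Sum>i\<in>A. c i *\<^sub>C e i))\<^sup>2 = (\<Sum>i\<in>A. (cmod (c i))\<^sup>2)"
  using assms norm_sum_square_orthogonal[of A "\<lambda>i. c i *\<^sub>C e i"]
  by (simp add: cinner_scaleC_left cinner_scaleC_right orthonormal_cinner norm_scaleC orthonormal_norm)

text \<open>For orthonormal e and finite A this is the orthogonal projection onto the span of the
  vectors with index in A; for infinite A the sum is 0 by convention.\<close>

definition oproj :: "(nat \<Rightarrow> 'a::chilbert_space) \<Rightarrow> nat set \<Rightarrow> 'a \<Rightarrow> 'a" where
  "oproj e A x = (\<Sum>i\<in>A. cinner x (e i) *\<^sub>C e i)"

lemma oproj_in_cspan: "A \<subseteq> B \<Longrightarrow> oproj e A x \<in> cspan (e ` B)"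
  unfolding oproj_def
  by (intro complex_vector.span_sum complex_vector.span_scale complex_vector.span_base) auto

lemma cinner_oproj:
  assumes "orthonormal e" "finite A"
  shows "cinner (oproj e A x) (e j) = (if j \<in> A then cinner x (e j) else 0)"
proof -
  have "cinner (oproj e A x) (e j) = (\<Sum>i\<in>A. if i = j then cinner x (e i) else 0)"
    unfolding oproj_def cinner.sum_left
    by (intro sum.cong) (simp_all add: cinner_scaleC_left orthonormal_cinner[OF assms(1)])
  then show ?thesis
    using assms(2) by simp
qed

lemma oproj_orthogonal:
  assumes "orthonormal e" "finite A" "z \<in> cspan (e ` A)"
  shows "cinner z (x - oproj e A x) = 0"
proof -
  have "cinner (e j) (x - oproj e A x) = 0" if "j \<in> A" for j
    by (subst cinner_commute) (simp add: cinner_diff_left cinner_oproj[OF assms(1,2)] that)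
  then show ?thesis
    using cspan_orthogonal[OF assms(3)] by fastforce
qed

lemma norm_oproj:
  assumes "orthonormal e" "finite A"
  shows "(norm (oproj e A x))\<^sup>2 = (\<Sum>i\<in>A. (cmod (cinner x (e i)))\<^sup>2)"
  unfolding oproj_def by (rule orthonormal_norm_sum[OF assms])

lemma oproj_eq:
  assumes "orthonormal e" "finite A" "x \<in> cspan (e ` A)"
  shows "oproj e A x = x"
proof -
  let ?z = "x - oproj e A x"
  have "?z \<in> cspan (e ` A)"
    using assms(3) oproj_in_cspan[of A A] by (intro complex_vector.span_diff) auto
  from oproj_orthogonal[OF assms(1,2) this, of x] have "?z = 0"
    by (simp add: cinner_self)
  then show ?thesis
    by simp
qed

lemma Bessel:
  assumes "orthonormal e" "finite A"
  shows "(\<Sum>i\<in>A. (cmod (cinner x (e i)))\<^sup>2) \<le> (norm x)\<^sup>2"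
proof -
  have "(norm x)\<^sup>2 = (norm (oproj e A x))\<^sup>2 + (norm (x - oproj e A x))\<^sup>2"
    using norm_add_square_orthogonal[OF oproj_orthogonal[OF assms oproj_in_cspan[of A A]], of x x]
    by simp
  then show ?thesis
    using norm_oproj[OF assms] by (metis le_add_same_cancel1 zero_le_power2)
qed

lemma summable_Bessel:
  assumes "orthonormal e"
  shows "summable (\<lambda>i. (cmod (cinner x (e i)))\<^sup>2)"
proof (rule summableI_nonneg_bounded)
  show "(\<Sum>i<n. (cmod (cinner x (e i)))\<^sup>2) \<le> (norm x)\<^sup>2" for n
    using Bessel[OF assms] by simp
qed simp

lemma cspan_image_lessThan:
  assumes "x \<in> cspan (range e)"
  shows "\<exists>N. x \<in> cspan (e ` {..<N :: nat})"
  using assms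
proof (induction rule: complex_vector.span_induct_alt)
  case base
  show ?case
    by (auto intro: complex_vector.span_zero)
next
  case (step c x y)
  then obtain i N where *: "x = e i" "y \<in> cspan (e ` {..<N})"
    by auto
  then have "e i \<in> cspan (e ` {..<max N (Suc i)})" "y \<in> cspan (e ` {..<max N (Suc i)})"
    using complex_vector.span_mono[OF image_mono, of "{..<N}" "{..<max N (Suc i)}" e]
    by (auto intro: complex_vector.span_base)
  then show ?case
    using * by (auto intro: complex_vector.span_add complex_vector.span_scale)
qed

lemma cspan_atLeast_orthogonal:
  assumes "orthonormal e" "x \<in> cspan (e ` {..<N})" "y \<in> cspan (e ` {N..})"
  shows "cinner x y = 0"
proof (rule cspan_orthogonal[OF assms(2)])
  fix s assume "s \<in> e ` {..<N}"
  then have "cinner y s = 0"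
    by (intro cspan_orthogonal[OF assms(3)]) (auto simp: orthonormal_cinner[OF assms(1)])
  then show "cinner s y = 0"
    by (subst cinner_commute) simp
qed

section \<open>Existence of an orthonormal basis\<close>

text \<open>Gram-Schmidt along a dense sequence d, arranged so that every step produces a new unit
  vector; infinite dimension supplies one when \<open>d k\<close> adds nothing.\<close>

lemma ex_orthonormal_basis:
  assumes separable: "separable_space (euclidean :: 'h::chilbert_space topology)"
    and infinite_dimensional: "\<not> (\<exists>B :: 'h set. finite B \<and> cspan B = UNIV)"
  shows "\<exists>e :: nat \<Rightarrow> 'h. orthonormal e \<and> closure (cspan (range e)) = UNIV"
proof -
  obtain C :: "'h set" where C: "countable C" "closure C = UNIV"
    using separable by (auto simp: separable_space_def)
  then have "C \<noteq> {}"
    by auto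
  define d where "d = from_nat_into C"
  have d: "range d = C"
    using C(1) \<open>C \<noteq> {}\<close> by (simp add: d_def range_from_nat_into)
  \<comment> \<open>The choice principle asks for a next vector after every initial segment, even
    one that is not orthonormal. The premise makes Q vacuous there and is discharged by induction
    once e is chosen.\<close>
  define Q where "Q = (\<lambda>(e :: nat \<Rightarrow> 'h) k r. (\<forall>j<k. norm (e j) = 1 \<and> (\<forall>i<j. cinner (e j) (e i) = 0)) \<longrightarrow>
      norm r = 1 \<and> (\<forall>i<k. cinner r (e i) = 0) \<and> d k \<in> cspan (insert r (e ` {..<k})))"
  have "\<exists>e. \<forall>k. Q e k (e k)"
  proof (rule dependent_wellorder_choice)
    fix r and f g :: "nat \<Rightarrow> 'h" and k assume "\<And>y. y < k \<Longrightarrow> f y = g y"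
    then show "Q f k r = Q g k r"
      unfolding Q_def by (intro arg_cong2[of _ _ _ _ "(\<longrightarrow>)"] arg_cong2[of _ _ _ _ "(\<and>)"])
        (auto simp: image_def cong: conj_cong)
  next
    fix k and e :: "nat \<Rightarrow> 'h"
    have "\<exists>r. norm r = 1 \<and> (\<forall>i<k. cinner r (e i) = 0) \<and> d k \<in> cspan (insert r (e ` {..<k}))"
      if on: "\<forall>j<k. norm (e j) = 1 \<and> (\<forall>i<j. cinner (e j) (e i) = 0)"
    proof -
      have on': "cinner (e i) (e j) = (if i = j then 1 else 0)" if "i < k" "j < k" for i j
        using on that cinner_commute[of "e i" "e j"]
        by (cases i j rule: linorder_cases) (simp_all add: cinner_self)
      let ?V = "cspan (e ` {..<k})"
      have "?V \<noteq> UNIV"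
        using infinite_dimensional by blast
      \<comment> \<open>If \<open>d k\<close> is outside the span it must be x itself, so that the
        new span contains it; otherwise any vector outside will do.\<close>
      then obtain x where x: "x \<notin> ?V" and dx: "d k \<notin> ?V \<Longrightarrow> x = d k"
        by (metis UNIV_eq_I)
      define p where "p = (\<Sum>i<k. cinner x (e i) *\<^sub>C e i)"
      have p: "p \<in> ?V"
        unfolding p_def
        by (intro complex_vector.span_sum complex_vector.span_scale complex_vector.span_base) auto
      define r where "r = complex_of_real (1 / norm (x - p)) *\<^sub>C (x - p)"
      have ne: "norm (x - p) \<noteq> 0"
        using x p by auto
      have "norm r = 1"
        using ne by (simp add: r_def norm_scaleC norm_divide)
      moreover have "cinner r (e i) = 0" if "i < k" for i
      proof -
        have "cinner p (e i) = (\<Sum>j<k. if j = i then cinner x (e j) else 0)"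
          unfolding p_def cinner.sum_left
          by (intro sum.cong) (simp_all add: cinner_scaleC_left on' that)
        then show ?thesis
          using that by (simp add: r_def cinner_scaleC_left cinner_diff_left)
      qed
      moreover have "d k \<in> cspan (insert r (e ` {..<k}))"
      proof (cases "d k \<in> ?V")
        case True
        then show ?thesis
          using complex_vector.span_mono[of "e ` {..<k}" "insert r (e ` {..<k})"] by auto
      next
        case False
        have "d k = complex_of_real (norm (x - p)) *\<^sub>C r + p"
          using ne dx[OF False] by (simp add: r_def scaleC_scaleC)
        moreover have "p \<in> cspan (insert r (e ` {..<k}))"
          using p complex_vector.span_mono[of "e ` {..<k}" "insert r (e ` {..<k})"] by auto
        ultimately show ?thesis
          by (auto intro: complex_vector.span_add complex_vector.span_scale complex_vector.span_base)
      qed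
      ultimately show ?thesis
        by blast
    qed
    then show "\<exists>r. Q e k r"
      unfolding Q_def by blast
  qed
  then obtain e where e: "\<And>k. Q e k (e k)"
    by blast
  have on: "norm (e k) = 1 \<and> (\<forall>i<k. cinner (e k) (e i) = 0)" for k
  proof (induction k rule: less_induct)
    case (less k)
    then show ?case
      using e[of k] by (simp add: Q_def)
  qed
  have "d k \<in> cspan (range e)" for k
  proof -
    have "d k \<in> cspan (insert (e k) (e ` {..<k}))"
      using e[of k] on by (simp add: Q_def)
    moreover have "insert (e k) (e ` {..<k}) \<subseteq> range e"
      by auto
    ultimately show ?thesis
      using complex_vector.span_mono by blast
  qed
  then have "C \<subseteq> cspan (range e)"
    using d by auto
  then have "closure (cspan (range e)) = UNIV"
    using C(2) closure_mono by blast
  moreover have "orthonormal e"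
    using on by (intro orthonormalI) auto
  ultimately show ?thesis
    by blast
qed

section \<open>Operators given by orthonormal sequences\<close>

lemma clinear_carrier: "T \<in> carrier bounded_operators \<longleftrightarrow> clinear T"
  by (simp add: bounded_operators_def clinear_def)

text \<open>It sends \<open>e i\<close> to \<open>c i *\<^sub>C u i\<close> and kills what is
  orthogonal to all \<open>e i\<close>. This one form covers diagonal operators, shifts along a
  subsequence of the basis and partial isometries. \<open>Blinfun\<close> is meaningful only for
  bounded maps, so its properties are derived for orthonormal e, u and bounded c.\<close>

definition frame_op ::
  "(nat \<Rightarrow> complex) \<Rightarrow> (nat \<Rightarrow> 'a::chilbert_space) \<Rightarrow> (nat \<Rightarrow> 'a) \<Rightarrow> 'a \<Rightarrow>\<^sub>L 'a" where
  "frame_op c e u = Blinfun (\<lambda>x. \<Sum>i. (c i * cinner x (e i)) *\<^sub>C u i)"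

context
  fixes c :: "nat \<Rightarrow> complex" and e u :: "nat \<Rightarrow> 'a::chilbert_space" and M :: real
  assumes e: "orthonormal e" and u: "orthonormal u" and M: "\<And>i. cmod (c i) \<le> M"
begin

lemma frame_M_nonneg: "0 \<le> M"
  using M[of 0] norm_ge_zero[of "c 0"] by linarith

lemma frame_sum_le:
  assumes "finite A"
  shows "(norm (\<Sum>i\<in>A. (c i * cinner x (e i)) *\<^sub>C u i))\<^sup>2 \<le> M\<^sup>2 * (\<Sum>i\<in>A. (cmod (cinner x (e i)))\<^sup>2)"
proof -
  have "(norm (\<Sum>i\<in>A. (c i * cinner x (e i)) *\<^sub>C u i))\<^sup>2 = (\<Sum>i\<in>A. (cmod (c i * cinner x (e i)))\<^sup>2)"
    by (rule orthonormal_norm_sum[OF u assms])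
  also have "\<dots> \<le> (\<Sum>i\<in>A. M\<^sup>2 * (cmod (cinner x (e i)))\<^sup>2)"
    using M by (intro sum_mono) (simp add: norm_mult power_mult_distrib mult_right_mono power_mono)
  finally show ?thesis
    by (simp add: sum_distrib_left)
qed

lemma frame_sum_norm_le:
  "finite A \<Longrightarrow> norm (\<Sum>i\<in>A. (c i * cinner x (e i)) *\<^sub>C u i) \<le> M * norm x"
proof (rule power2_le_imp_le)
  assume A: "finite A"
  have "(norm (\<Sum>i\<in>A. (c i * cinner x (e i)) *\<^sub>C u i))\<^sup>2 \<le> M\<^sup>2 * (\<Sum>i\<in>A. (cmod (cinner x (e i)))\<^sup>2)"
    by (rule frame_sum_le[OF A])
  also have "\<dots> \<le> M\<^sup>2 * (norm x)\<^sup>2"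
    by (intro mult_left_mono Bessel[OF e A]) simp
  finally show "(norm (\<Sum>i\<in>A. (c i * cinner x (e i)) *\<^sub>C u i))\<^sup>2 \<le> (M * norm x)\<^sup>2"
    by (simp add: power_mult_distrib)
qed (simp add: frame_M_nonneg)

text \<open>Convergence is only in the square-summable sense: Pythagoras turns a partial sum into a
  sum of squares, whose tails Bessel makes small, and completeness does the rest.\<close>

lemma frame_summable: "summable (\<lambda>i. (c i * cinner x (e i)) *\<^sub>C u i)"
  unfolding summable_Cauchy
proof (intro allI impI)
  fix \<epsilon> :: real assume \<epsilon>: "\<epsilon> > 0"
  \<comment> \<open>M may be 0, hence the division by M + 1.\<close>
  define \<delta> where "\<delta> = (\<epsilon> / (M + 1))\<^sup>2"
  have M0: "0 < M + 1"
    using frame_M_nonneg by simp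
  have "\<delta> > 0"
    using \<epsilon> M0 by (simp add: \<delta>_def)
  then obtain N where N: "\<And>m n. m \<ge> N \<Longrightarrow> norm (\<Sum>i=m..<n. (cmod (cinner x (e i)))\<^sup>2) < \<delta>"
    using summable_Bessel[OF e, of x] unfolding summable_Cauchy by blast
  have "norm (\<Sum>i=m..<n. (c i * cinner x (e i)) *\<^sub>C u i) < \<epsilon>" if "m \<ge> N" for m n
  proof (rule power2_less_imp_less)
    let ?S = "\<Sum>i=m..<n. (cmod (cinner x (e i)))\<^sup>2"
    have S: "0 \<le> ?S" "?S < \<delta>"
      using N[OF that, of n] by (auto intro: sum_nonneg)
    have "(norm (\<Sum>i=m..<n. (c i * cinner x (e i)) *\<^sub>C u i))\<^sup>2 \<le> M\<^sup>2 * ?S"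
      by (rule frame_sum_le) simp
    also have "\<dots> \<le> (M + 1)\<^sup>2 * ?S"
      using S frame_M_nonneg by (intro mult_right_mono power_mono) auto
    also have "\<dots> < (M + 1)\<^sup>2 * \<delta>"
      using S M0 by (intro mult_strict_left_mono) auto
    also have "\<dots> = \<epsilon>\<^sup>2"
      using M0 by (simp add: \<delta>_def power_divide)
    finally show "(norm (\<Sum>i=m..<n. (c i * cinner x (e i)) *\<^sub>C u i))\<^sup>2 < \<epsilon>\<^sup>2" .
  qed (use \<epsilon> in simp)
  then show "\<exists>N. \<forall>m\<ge>N. \<forall>n. norm (\<Sum>i=m..<n. (c i * cinner x (e i)) *\<^sub>C u i) < \<epsilon>"
    by blast
qed

lemma frame_suminf_scaleC:
  "(\<Sum>i. (c i * cinner (a *\<^sub>C x) (e i)) *\<^sub>C u i) = a *\<^sub>C (\<Sum>i. (c i * cinner x (e i)) *\<^sub>C u i)"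
proof -
  have "a *\<^sub>C (\<Sum>i. (c i * cinner x (e i)) *\<^sub>C u i) = (\<Sum>i. a *\<^sub>C (c i * cinner x (e i)) *\<^sub>C u i)"
    by (rule bounded_linear.suminf[OF bounded_linear_scaleC frame_summable])
  then show ?thesis
    by (simp add: scaleC_scaleC cinner_scaleC_left mult.left_commute)
qed

lemma frame_suminf_norm_le: "norm (\<Sum>i. (c i * cinner x (e i)) *\<^sub>C u i) \<le> M * norm x"
proof (rule Lim_norm_ubound[OF sequentially_bot])
  show "(\<lambda>n. \<Sum>i<n. (c i * cinner x (e i)) *\<^sub>C u i) \<longlonglongrightarrow> (\<Sum>i. (c i * cinner x (e i)) *\<^sub>C u i)"
    by (rule summable_LIMSEQ[OF frame_summable])
qed (simp add: frame_sum_norm_le)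

lemma frame_op_apply: "frame_op c e u x = (\<Sum>i. (c i * cinner x (e i)) *\<^sub>C u i)"
  unfolding frame_op_def
proof (subst bounded_linear_Blinfun_apply)
  show "bounded_linear (\<lambda>x. \<Sum>i. (c i * cinner x (e i)) *\<^sub>C u i)"
  proof (rule bounded_linear_intro[of _ M])
    show "(\<Sum>i. (c i * cinner (x + y) (e i)) *\<^sub>C u i) =
        (\<Sum>i. (c i * cinner x (e i)) *\<^sub>C u i) + (\<Sum>i. (c i * cinner y (e i)) *\<^sub>C u i)" for x y
      by (subst suminf_add[OF frame_summable frame_summable])
        (simp add: cinner_add_left distrib_left scaleC_add_left)
    show "(\<Sum>i. (c i * cinner (r *\<^sub>R x) (e i)) *\<^sub>C u i) = r *\<^sub>R (\<Sum>i. (c i * cinner x (e i)) *\<^sub>C u i)" for r x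
      by (simp only: scaleR_scaleC frame_suminf_scaleC)
    show "norm (\<Sum>i. (c i * cinner x (e i)) *\<^sub>C u i) \<le> norm x * M" for x
      using frame_suminf_norm_le[of x] by (simp add: mult.commute)
  qed
qed simp

lemma clinear_frame_op: "clinear (frame_op c e u)"
  by (simp add: clinear_def frame_op_apply frame_suminf_scaleC)

lemma norm_frame_op_apply: "norm (frame_op c e u x) \<le> M * norm x"
  by (simp add: frame_op_apply frame_suminf_norm_le)

lemma norm_frame_op: "norm (frame_op c e u) \<le> M"
  by (rule norm_blinfun_bound) (simp_all add: frame_M_nonneg norm_frame_op_apply)

lemma frame_op_basis: "frame_op c e u (e j) = c j *\<^sub>C u j"
proof -
  have "(\<lambda>i. (c i * cinner (e j) (e i)) *\<^sub>C u i) = (\<lambda>i. if i = j then c i *\<^sub>C u i else 0)"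
    by (auto simp: orthonormal_cinner[OF e] fun_eq_iff)
  then show ?thesis
    using sums_single[of j "\<lambda>i. c i *\<^sub>C u i"] by (simp add: frame_op_apply sums_iff)
qed

lemma cinner_frame_op: "cinner (frame_op c e u x) (u j) = c j * cinner x (e j)"
proof -
  have "cinner (frame_op c e u x) (u j) = (\<Sum>i. cinner ((c i * cinner x (e i)) *\<^sub>C u i) (u j))"
    unfolding frame_op_apply
    by (rule bounded_linear.suminf[OF cinner.bounded_linear_left frame_summable])
  moreover have "(\<lambda>i. cinner ((c i * cinner x (e i)) *\<^sub>C u i) (u j)) =
      (\<lambda>i. if i = j then c i * cinner x (e i) else 0)"
    by (auto simp: cinner_scaleC_left orthonormal_cinner[OF u] fun_eq_iff)
  ultimately show ?thesis
    using sums_single[of j "\<lambda>i. c i * cinner x (e i)"] by (simp add: sums_iff)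
qed

lemma frame_op_cspan:
  assumes "x \<in> cspan (e ` A)"
  shows "frame_op c e u x \<in> cspan (u ` A)"
  using assms
proof (induction rule: complex_vector.span_induct_alt)
  case (step d b y)
  then obtain j where j: "b = e j" "j \<in> A"
    by auto
  have "frame_op c e u (d *\<^sub>C b + y) = (d * c j) *\<^sub>C u j + frame_op c e u y"
    using clinear_frame_op frame_op_basis[of j]
    by (simp add: blinfun.add_right clinear_def j scaleC_scaleC)
  then show ?case
    using step j by (auto intro: complex_vector.span_add complex_vector.span_scale complex_vector.span_base)
qed (simp add: blinfun.zero_right complex_vector.span_zero)

end

text \<open>Only y has to lie in the span of e, which allows induction over finite combinations. The
  vector x stays arbitrary because the identity is later applied with \<open>b x\<close> in its
  place, which may leave that span.\<close>

lemma frame_op_isometry: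
  assumes e: "orthonormal e" and u: "orthonormal u" and y: "y \<in> cspan (range e)"
  shows "cinner (frame_op (\<lambda>i. 1) e u x) (frame_op (\<lambda>i. 1) e u y) = cinner x y"
  using y
proof (induction rule: complex_vector.span_induct_alt)
  case (step c b y)
  obtain j where j: "b = e j"
    using step(1) by auto
  let ?T = "frame_op (\<lambda>i. 1) e u"
  have "?T (c *\<^sub>C b + y) = c *\<^sub>C u j + ?T y"
    using clinear_frame_op[OF e u, of "\<lambda>i. 1" 1] frame_op_basis[OF e u, of "\<lambda>i. 1" 1]
    by (simp add: blinfun.add_right clinear_def j scaleC_one)
  then show ?case
    using step cinner_frame_op[OF e u, of "\<lambda>i. 1" 1]
    by (simp add: cinner_add_right cinner_scaleC_right j)
qed (simp add: blinfun.zero_right)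

text \<open>Since T preserves inner products against x, the number \<open>cinner (b x) x\<close>
  equals \<open>cinner (T (b x)) (T x)\<close>, and the difference is the commutator tested at x and
  T x.\<close>

lemma frame_op_intertwines:
  fixes b :: "'a::chilbert_space \<Rightarrow>\<^sub>L 'a"
  assumes e: "orthonormal e" and u: "orthonormal u" and x: "x \<in> cspan (range e)" "norm x = 1"
  defines "T \<equiv> frame_op (\<lambda>i. 1) e u"
  shows "norm (T x) = 1"
    and "cmod (cinner (b (T x)) (T x) - cinner (b x) x) \<le> norm ((b o\<^sub>L T) - (T o\<^sub>L b))"
proof -
  have "cinner (T x) (T x) = cinner x x"
    unfolding T_def by (rule frame_op_isometry[OF e u x(1)])
  also have "\<dots> = 1"
    by (simp add: cinner_self x(2))
  finally have "cinner (T x) (T x) = 1" .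
  then show n: "norm (T x) = 1"
    by (simp add: norm_eq_sqrt_cinner)
  have "cinner (b (T x)) (T x) - cinner (b x) x = cinner (((b o\<^sub>L T) - (T o\<^sub>L b)) x) (T x)"
    using frame_op_isometry[OF e u x(1), of "b x"]
    by (simp add: T_def blinfun.diff_left cinner_diff_left)
  also have "cmod \<dots> \<le> norm (((b o\<^sub>L T) - (T o\<^sub>L b)) x) * norm (T x)"
    by (rule Cauchy_Schwarz_cinner)
  also have "\<dots> \<le> norm ((b o\<^sub>L T) - (T o\<^sub>L b))"
    using norm_blinfun[of "(b o\<^sub>L T) - (T o\<^sub>L b)" x] by (simp add: n x(2))
  finally show "cmod (cinner (b (T x)) (T x) - cinner (b x) x) \<le> norm ((b o\<^sub>L T) - (T o\<^sub>L b))" .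
qed

section \<open>Spread of the numerical range\<close>

text \<open>No closure is taken: vectors of finite support allow later ones to start beyond the
  support of all earlier ones, which makes them exactly orthogonal.\<close>

definition unit_tail :: "(nat \<Rightarrow> 'a::chilbert_space) \<Rightarrow> nat \<Rightarrow> 'a set" where
  "unit_tail e i = {x \<in> cspan (e ` {i..}). norm x = 1}"

definition spread :: "(nat \<Rightarrow> 'a::chilbert_space) \<Rightarrow> ('a \<Rightarrow>\<^sub>L 'a) \<Rightarrow> nat \<Rightarrow> real" where
  "spread e b i =
    (SUP (x, y) \<in> unit_tail e i \<times> unit_tail e i. cmod (cinner (b x) x - cinner (b y) y))"

lemma cmod_numerical_le:
  fixes b :: "'a::chilbert_space \<Rightarrow>\<^sub>L 'a"
  assumes "norm x = 1"
  shows "cmod (cinner (b x) x) \<le> norm b"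
  using Cauchy_Schwarz_cinner[of "b x" x] norm_blinfun[of b x] assms by simp

lemma unit_tail_antimono: "i \<le> j \<Longrightarrow> unit_tail e j \<subseteq> unit_tail e i"
  using complex_vector.span_mono[OF image_mono, of "{j..}" "{i..}" e]
  by (auto simp: unit_tail_def)

lemma basis_in_unit_tail: "orthonormal e \<Longrightarrow> e i \<in> unit_tail e i"
  by (simp add: unit_tail_def orthonormal_norm complex_vector.span_base)

context
  fixes e :: "nat \<Rightarrow> 'a::chilbert_space"
  assumes e: "orthonormal e"
begin

lemma numerical_diff_le:
  fixes b :: "'a \<Rightarrow>\<^sub>L 'a"
  assumes "x \<in> unit_tail e i" "y \<in> unit_tail e i"
  shows "cmod (cinner (b x) x - cinner (b y) y) \<le> 2 * norm b"
proof -
  have "cmod (cinner (b x) x - cinner (b y) y) \<le> cmod (cinner (b x) x) + cmod (cinner (b y) y)"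
    by (rule norm_triangle_ineq4)
  then show ?thesis
    using assms cmod_numerical_le[of x b] cmod_numerical_le[of y b] by (simp add: unit_tail_def)
qed

lemma spread_upper:
  fixes b :: "'a \<Rightarrow>\<^sub>L 'a"
  assumes "x \<in> unit_tail e i" "y \<in> unit_tail e i"
  shows "cmod (cinner (b x) x - cinner (b y) y) \<le> spread e b i"
proof -
  have "bdd_above ((\<lambda>(x, y). cmod (cinner (b x) x - cinner (b y) y)) ` (unit_tail e i \<times> unit_tail e i))"
    by (rule bdd_aboveI2[of _ _ "2 * norm b"]) (auto intro: numerical_diff_le)
  then show ?thesis
    unfolding spread_def using assms by (intro cSUP_upper2[where x = "(x, y)"]) auto
qed

lemma spread_least:
  fixes b :: "'a \<Rightarrow>\<^sub>L 'a"
  assumes "\<And>x y. x \<in> unit_tail e i \<Longrightarrow> y \<in> unit_tail e i \<Longrightarrow> cmod (cinner (b x) x - cinner (b y) y) \<le> B"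
  shows "spread e b i \<le> B"
  unfolding spread_def using assms basis_in_unit_tail[OF e, of i] by (intro cSUP_least) auto

lemma spread_nonneg: "0 \<le> spread e b i"
  using spread_upper[of "e i" i "e i" b] basis_in_unit_tail[OF e] by simp

lemma spread_le: "spread e b i \<le> 2 * norm b"
  by (intro spread_least numerical_diff_le)

lemma spread_antimono: "i \<le> j \<Longrightarrow> spread e b j \<le> spread e b i"
  using unit_tail_antimono by (intro spread_least spread_upper) blast+

lemma spread_attained:
  fixes b :: "'a \<Rightarrow>\<^sub>L 'a"
  assumes "\<epsilon> > 0"
  shows "\<exists>x\<in>unit_tail e i. \<exists>y\<in>unit_tail e i. spread e b i - \<epsilon> \<le> cmod (cinner (b x) x - cinner (b y) y)"
proof (rule ccontr)
  assume "\<not> ?thesis"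
  then have "spread e b i \<le> spread e b i - \<epsilon>"
    by (intro spread_least) fastforce
  then show False
    using assms by simp
qed

lemma spread_LIMSEQ: "spread e b \<longlonglongrightarrow> (INF i. spread e b i)"
  using spread_antimono spread_nonneg
  by (intro LIMSEQ_decseq_INF) (auto intro!: bdd_belowI2[of _ 0] simp: decseq_def)

lemma spread_INF_le: "(INF i. spread e b i) \<le> spread e b j"
  using spread_nonneg by (intro cINF_lower bdd_belowI2[of _ 0]) auto

lemma spread_INF_nonneg: "0 \<le> (INF i. spread e b i)"
  using spread_nonneg by (intro cINF_greatest) auto

text \<open>Shifting the basis along \<open>f\<close> is an isometry, so a small commutator with it forces the
  spread to decrease slowly.\<close>

lemma spread_shift:
  assumes f: "strict_mono f"
  defines "T \<equiv> frame_op (\<lambda>i. 1) e (\<lambda>i. e (f i))"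
  shows "spread e b i \<le> spread e b (f i) + 2 * norm ((b o\<^sub>L T) - (T o\<^sub>L b))"
proof (rule spread_least)
  fix x y assume xy: "x \<in> unit_tail e i" "y \<in> unit_tail e i"
  have u: "orthonormal (\<lambda>i. e (f i))"
    by (rule orthonormal_comp[OF e strict_mono_imp_inj_on[OF f]])
  have T: "T z \<in> unit_tail e (f i)"
    "cmod (cinner (b (T z)) (T z) - cinner (b z) z) \<le> norm ((b o\<^sub>L T) - (T o\<^sub>L b))"
    if z: "z \<in> unit_tail e i" for z
  proof -
    have z': "z \<in> cspan (e ` {i..})" "norm z = 1"
      using z by (auto simp: unit_tail_def)
    have "z \<in> cspan (range e)"
      using z' complex_vector.span_mono[of "e ` {i..}" "range e"] by auto
    note * = frame_op_intertwines[OF e u this z'(2), folded T_def]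
    have "(\<lambda>i. e (f i)) ` {i..} \<subseteq> e ` {f i..}"
      using f by (auto simp: strict_mono_less_eq)
    then have "cspan ((\<lambda>i. e (f i)) ` {i..}) \<subseteq> cspan (e ` {f i..})"
      by (rule complex_vector.span_mono)
    moreover have "T z \<in> cspan ((\<lambda>i. e (f i)) ` {i..})"
      unfolding T_def by (rule frame_op_cspan[OF e u _ z'(1), of _ 1]) simp
    ultimately have "T z \<in> cspan (e ` {f i..})"
      by blast
    with * show "T z \<in> unit_tail e (f i)"
      "cmod (cinner (b (T z)) (T z) - cinner (b z) z) \<le> norm ((b o\<^sub>L T) - (T o\<^sub>L b))"
      by (auto simp: unit_tail_def)
  qed
  \<comment> \<open>Moving x and y to their images costs one commutator norm each, whence the factor
    2.\<close>
  have "cinner (b x) x - cinner (b y) y =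
      (cinner (b (T x)) (T x) - cinner (b (T y)) (T y))
      - (cinner (b (T x)) (T x) - cinner (b x) x) + (cinner (b (T y)) (T y) - cinner (b y) y)"
    by simp
  also have "cmod \<dots> \<le> cmod (cinner (b (T x)) (T x) - cinner (b (T y)) (T y))
      + cmod (cinner (b (T x)) (T x) - cinner (b x) x) + cmod (cinner (b (T y)) (T y) - cinner (b y) y)"
    by (meson add_mono norm_triangle_ineq norm_triangle_ineq4 order_refl order_trans)
  also have "\<dots> \<le> spread e b (f i) + norm ((b o\<^sub>L T) - (T o\<^sub>L b)) + norm ((b o\<^sub>L T) - (T o\<^sub>L b))"
    using T xy by (intro add_mono spread_upper) auto
  finally show "cmod (cinner (b x) x - cinner (b y) y) \<le> spread e b (f i) + 2 * norm ((b o\<^sub>L T) - (T o\<^sub>L b))"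
    by simp
qed

text \<open>A single operator detects the limit spreads of a whole sequence of operators: pairs of
  vectors that nearly attain these can be picked successively so far out that they form two
  orthonormal sequences, and one partial isometry takes each vector to its partner.\<close>

lemma ex_operator_detecting_limit_spread:
  "\<exists>T. clinear T \<and> (\<forall>n. (INF i. spread e (b n) i) \<le> norm ((b n o\<^sub>L T) - (T o\<^sub>L b n)) + inverse (real (Suc n)))"
proof -
  \<comment> \<open>As in the construction of the basis, the premise handles arbitrary initial
    segments. Membership in the span is what guarantees that the earlier pairs have bounded
    support.\<close>
  define Q where "Q = (\<lambda>(z :: nat \<Rightarrow> 'a \<times> 'a) n r.
    (\<forall>m<n. z m \<in> unit_tail e 0 \<times> unit_tail e 0) \<longrightarrow>
    r \<in> unit_tail e 0 \<times> unit_tail e 0 \<and>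
    (\<forall>m<n. cinner (fst r) (fst (z m)) = 0 \<and> cinner (snd r) (snd (z m)) = 0) \<and>
    (INF i. spread e (b n) i) \<le>
      cmod (cinner (b n (fst r)) (fst r) - cinner (b n (snd r)) (snd r)) + inverse (real (Suc n)))"
  have "\<exists>z. \<forall>n. Q z n (z n)"
  proof (rule dependent_wellorder_choice)
    fix r and f g :: "nat \<Rightarrow> 'a \<times> 'a" and n assume "\<And>y. y < n \<Longrightarrow> f y = g y"
    then show "Q f n r = Q g n r"
      by (simp add: Q_def)
  next
    fix n and z :: "nat \<Rightarrow> 'a \<times> 'a"
    have "\<exists>r. r \<in> unit_tail e 0 \<times> unit_tail e 0 \<and>
        (\<forall>m<n. cinner (fst r) (fst (z m)) = 0 \<and> cinner (snd r) (snd (z m)) = 0) \<and>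
        (INF i. spread e (b n) i) \<le>
          cmod (cinner (b n (fst r)) (fst r) - cinner (b n (snd r)) (snd r)) + inverse (real (Suc n))"
      if z: "\<forall>m<n. z m \<in> unit_tail e 0 \<times> unit_tail e 0"
    proof -
      have "\<exists>N. \<forall>m<n. fst (z m) \<in> cspan (e ` {..<N}) \<and> snd (z m) \<in> cspan (e ` {..<N})"
      proof -
        have "\<exists>N. fst (z m) \<in> cspan (e ` {..<N}) \<and> snd (z m) \<in> cspan (e ` {..<N})" if "m < n" for m
        proof -
          have "fst (z m) \<in> cspan (range e)" "snd (z m) \<in> cspan (range e)"
            using z that complex_vector.span_mono[of "e ` {0..}" "range e"]
            by (auto simp: unit_tail_def mem_Times_iff)
          then obtain N1 N2 where "fst (z m) \<in> cspan (e ` {..<N1})" "snd (z m) \<in> cspan (e ` {..<N2})"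
            using cspan_image_lessThan by metis
          then show ?thesis
            using complex_vector.span_mono[OF image_mono, of "{..<N1}" "{..<max N1 N2}" e]
              complex_vector.span_mono[OF image_mono, of "{..<N2}" "{..<max N1 N2}" e]
            by (intro exI[of _ "max N1 N2"]) auto
        qed
        then obtain N where N: "\<And>m. m < n \<Longrightarrow>
            fst (z m) \<in> cspan (e ` {..<N m}) \<and> snd (z m) \<in> cspan (e ` {..<N m})"
          by metis
        \<comment> \<open>For n = 0 the maximum is over the empty set, but then there is no m to
          consider.\<close>
        have "cspan (e ` {..<N m}) \<subseteq> cspan (e ` {..<Max (N ` {..<n})})" if "m < n" for m
          using that by (intro complex_vector.span_mono image_mono lessThan_subset_iff[THEN iffD2] Max_ge) auto
        then show ?thesis
          using N by (intro exI[of _ "Max (N ` {..<n})"]) blast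
      qed
      then obtain N where N: "\<And>m. m < n \<Longrightarrow>
          fst (z m) \<in> cspan (e ` {..<N}) \<and> snd (z m) \<in> cspan (e ` {..<N})"
        by blast
      \<comment> \<open>The spread at N is at least the limit spread. The supremum need not be
        attained, so an error is allowed that tends to 0 with n.\<close>
      obtain x y where xy: "x \<in> unit_tail e N" "y \<in> unit_tail e N"
        and s: "spread e (b n) N - inverse (real (Suc n)) \<le> cmod (cinner (b n x) x - cinner (b n y) y)"
        using spread_attained[of "inverse (real (Suc n))" N "b n"] by auto
      have "cinner x (fst (z m)) = 0 \<and> cinner y (snd (z m)) = 0" if "m < n" for m
        using cspan_atLeast_orthogonal[OF e, of "fst (z m)" N x]
          cspan_atLeast_orthogonal[OF e, of "snd (z m)" N y] N[OF that] xy
          cinner_commute[of x "fst (z m)"] cinner_commute[of y "snd (z m)"]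
        by (simp add: unit_tail_def)
      then show ?thesis
        using xy unit_tail_antimono[of 0 N e] s spread_INF_le[of "b n" N]
        by (intro exI[of _ "(x, y)"]) auto
    qed
    then show "\<exists>r. Q z n r"
      unfolding Q_def by blast
  qed
  then obtain z where z: "\<And>n. Q z n (z n)"
    by blast
  have z0: "z n \<in> unit_tail e 0 \<times> unit_tail e 0" for n
    using z by (induction n rule: less_induct) (simp add: Q_def)
  define x y where "x n = fst (z n)" and "y n = snd (z n)" for n
  have xy: "norm (x n) = 1" "norm (y n) = 1" for n
    using z0[of n] by (auto simp: x_def y_def unit_tail_def mem_Times_iff)
  have o: "orthonormal x" "orthonormal y"
    using z z0 xy by (auto intro!: orthonormalI simp: Q_def x_def y_def)
  \<comment> \<open>The \<open>x n\<close> are orthonormal among themselves and so are the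
    \<open>y n\<close>; this is all that a partial isometry from one sequence to the other
    requires.\<close>
  define T where "T = frame_op (\<lambda>i. 1) y x"
  have T: "T (y n) = x n" for n
    using frame_op_basis[OF o(2,1), of "\<lambda>i. 1" 1] by (simp add: T_def scaleC_one)
  have "(INF i. spread e (b n) i) \<le> norm ((b n o\<^sub>L T) - (T o\<^sub>L b n)) + inverse (real (Suc n))" for n
  proof -
    have "(INF i. spread e (b n) i) \<le>
        cmod (cinner (b n (x n)) (x n) - cinner (b n (y n)) (y n)) + inverse (real (Suc n))"
      using z[of n] z0 by (simp add: Q_def x_def y_def)
    moreover have "cmod (cinner (b n (T (y n))) (T (y n)) - cinner (b n (y n)) (y n)) \<le>
        norm ((b n o\<^sub>L T) - (T o\<^sub>L b n))"
      unfolding T_def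
      by (rule frame_op_intertwines[OF o(2,1)]) (simp_all add: complex_vector.span_base xy)
    ultimately show ?thesis
      by (simp add: T)
  qed
  moreover have "clinear T"
    unfolding T_def by (rule clinear_frame_op[OF o(2,1), of _ 1]) simp
  ultimately show ?thesis
    by blast
qed

text \<open>Subtracting one value of the numerical range leaves an operator whose numerical radius
  is at most the diameter; the factor 4 is that of polarization.\<close>

lemma norm_diff_scalar_le_spread:
  fixes b :: "'a \<Rightarrow>\<^sub>L 'a"
  assumes basis: "closure (cspan (range e)) = UNIV" and b: "clinear b"
  shows "norm (b - scaleC_blinfun (cinner (b (e 0)) (e 0)) id_blinfun) \<le> 4 * spread e b 0"
proof (rule norm_le_numerical_radius[OF _ basis])
  show "clinear (b - scaleC_blinfun (cinner (b (e 0)) (e 0)) id_blinfun)"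
    using b by (simp add: clinear_def blinfun.diff_left scaleC_blinfun.rep_eq scaleC_scaleC
        complex_vector.scale_right_diff_distrib mult.commute)
  fix x assume x: "x \<in> cspan (range e)" "norm x = 1"
  then have "cmod (cinner (b x) x - cinner (b (e 0)) (e 0)) \<le> spread e b 0"
    using basis_in_unit_tail[OF e, of 0] by (intro spread_upper) (auto simp: unit_tail_def atLeast_0)
  then show "cmod (cinner ((b - scaleC_blinfun (cinner (b (e 0)) (e 0)) id_blinfun) x) x) \<le> spread e b 0"
    using x by (simp add: blinfun.diff_left scaleC_blinfun.rep_eq cinner_diff_left cinner_scaleC_left
        cinner_self)
qed (simp_all add: spread_nonneg complex_vector.subspace_span)

end

section \<open>Ultrafilters and relative commutants\<close>

lemma ultrafilter_not_eventually:
  "nonprincipal_ultrafilter \<alpha> \<Longrightarrow> \<not> eventually P \<alpha> \<Longrightarrow> eventually (\<lambda>n. \<not> P n) \<alpha>"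
  by (auto simp: nonprincipal_ultrafilter_def)

lemma nonprincipal_ultrafilter_le_sequentially:
  assumes "nonprincipal_ultrafilter \<alpha>"
  shows "\<alpha> \<le> sequentially"
  unfolding le_sequentially
proof
  fix N show "eventually (\<lambda>n. N \<le> n) \<alpha>"
  proof (induction N)
    case (Suc N)
    have "eventually (\<lambda>n. n \<noteq> N) \<alpha>"
      using assms by (intro ultrafilter_not_eventually) (auto simp: nonprincipal_ultrafilter_def)
    with Suc show ?case
      by eventually_elim simp
  qed simp
qed

text \<open>Compactness gives a cluster point. An ultrafilter that does not eventually enter a
  neighbourhood eventually avoids it, so a cluster point is a limit.\<close>

lemma ultrafilter_limit_exists:
  fixes g :: "'a \<Rightarrow> 'b::heine_borel"
  assumes u: "nonprincipal_ultrafilter \<alpha>" and bd: "bounded (range g)"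
  shows "\<exists>c. (g \<longlongrightarrow> c) \<alpha>"
proof -
  have "compact (closure (range g))"
    using bd by (simp add: compact_eq_bounded_closed bounded_closure)
  moreover have "filtermap g \<alpha> \<noteq> bot"
    using u by (simp add: nonprincipal_ultrafilter_def filtermap_bot_iff)
  moreover have "eventually (\<lambda>y. y \<in> closure (range g)) (filtermap g \<alpha>)"
    using closure_subset[of "range g"] by (auto simp: eventually_filtermap intro!: always_eventually)
  ultimately obtain c where c: "inf (nhds c) (filtermap g \<alpha>) \<noteq> bot"
    unfolding compact_filter by blast
  have "eventually (\<lambda>n. g n \<in> S) \<alpha>" if S: "open S" "c \<in> S" for S
  proof (rule ccontr)
    assume "\<not> ?thesis"
    then have "eventually (\<lambda>n. g n \<notin> S) \<alpha>"
      by (rule ultrafilter_not_eventually[OF u])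
    then have "eventually (\<lambda>y. y \<notin> S) (filtermap g \<alpha>)"
      by (simp add: eventually_filtermap)
    moreover have "eventually (\<lambda>y. y \<in> S) (nhds c)"
      using S by (rule eventually_nhds_in_open)
    ultimately have "eventually (\<lambda>_. False) (inf (nhds c) (filtermap g \<alpha>))"
      unfolding eventually_inf by blast
    then show False
      using c by (simp add: eventually_False)
  qed
  then show ?thesis
    by (auto intro: topological_tendstoI)
qed

section \<open>From cosets to sequences of operators\<close>

lemma bounded_seq_carrier:
  "x \<in> carrier (bounded_seq_ring (bounded_operators :: (complex, 'h::chilbert_space \<Rightarrow>\<^sub>L 'h) module)) \<longleftrightarrow>
    (\<forall>n. clinear (x n)) \<and> bounded (range x)"
  by (auto simp: bounded_seq_ring_def clinear_carrier[symmetric])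

lemma bounded_seq_ring_minus:
  fixes x y :: "nat \<Rightarrow> 'h::chilbert_space \<Rightarrow>\<^sub>L 'h"
  defines "R \<equiv> bounded_seq_ring (bounded_operators :: (complex, 'h \<Rightarrow>\<^sub>L 'h) module)"
  assumes "x \<in> carrier R" "y \<in> carrier R"
  shows "x \<ominus>\<^bsub>R\<^esub> y = (\<lambda>n. x n - y n)"
proof -
  \<comment> \<open>Any filter would do: the ideal serves only to supply the ring of bounded
    sequences.\<close>
  have "ideal (null_seqs bot (bounded_operators :: (complex, 'h \<Rightarrow>\<^sub>L 'h) module)) R"
    unfolding R_def by (rule ideal_null_seqs)
  then interpret R: ring R
    by (rule ideal.axioms(2))
  have ops: "\<zero>\<^bsub>R\<^esub> = (\<lambda>n. 0)" "u \<oplus>\<^bsub>R\<^esub> v = (\<lambda>n. u n + v n)" for u v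
    by (simp_all add: R_def bounded_seq_ring_def bounded_operators_def)
  have "bounded (range (\<lambda>n. - y n))"
    using assms(3) unfolding R_def bounded_seq_carrier by (auto simp: bounded_iff)
  then have "(\<lambda>n. - y n) \<in> carrier R"
    using assms(3) unfolding R_def bounded_seq_carrier
    by (simp add: clinear_def blinfun.minus_left)
  then have "\<ominus>\<^bsub>R\<^esub> y = (\<lambda>n. - y n)"
    using assms(3) by (intro R.minus_equality) (simp_all add: ops)
  then show ?thesis
    by (simp add: a_minus_def ops)
qed

lemma null_coset_eq_iff:
  fixes x y :: "nat \<Rightarrow> 'h::chilbert_space \<Rightarrow>\<^sub>L 'h"
  defines "A \<equiv> bounded_operators :: (complex, 'h \<Rightarrow>\<^sub>L 'h) module"
  assumes x: "x \<in> carrier (bounded_seq_ring A)" and y: "y \<in> carrier (bounded_seq_ring A)"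
  shows "null_seqs \<alpha> A +>\<^bsub>bounded_seq_ring A\<^esub> x = null_seqs \<alpha> A +>\<^bsub>bounded_seq_ring A\<^esub> y \<longleftrightarrow>
    ((\<lambda>n. norm (x n - y n)) \<longlongrightarrow> 0) \<alpha>"
proof -
  have I: "ideal (null_seqs \<alpha> A) (bounded_seq_ring A)"
    unfolding A_def by (rule ideal_null_seqs)
  then interpret R: ring "bounded_seq_ring A"
    by (rule ideal.axioms(2))
  have "x \<ominus>\<^bsub>bounded_seq_ring A\<^esub> y \<in> carrier (bounded_seq_ring A)"
    using x y by simp
  then show ?thesis
    using R.quotient_eq_iff_same_a_r_cos[OF I x y] bounded_seq_ring_minus[of x y] x y
    by (simp add: null_seqs_def A_def)
qed

text \<open>Scalars always commute, so the two sets differ exactly when some class commutes without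
  being scalar. From here on only sequences of operators occur, no cosets.\<close>

lemma commutant_nontrivial_iff:
  fixes \<alpha> :: "nat filter"
  defines "A \<equiv> bounded_operators :: (complex, 'h::chilbert_space \<Rightarrow>\<^sub>L 'h) module"
  shows "ultrapower_commutant \<alpha> A \<noteq> ultrapower_scalars \<alpha> A \<longleftrightarrow>
    (\<exists>x :: nat \<Rightarrow> 'h \<Rightarrow>\<^sub>L 'h. (\<forall>n. clinear (x n)) \<and> bounded (range x) \<and>
      (\<forall>a. clinear a \<longrightarrow> ((\<lambda>n. norm ((x n o\<^sub>L a) - (a o\<^sub>L x n))) \<longlongrightarrow> 0) \<alpha>) \<and>
      \<not> (\<exists>c. ((\<lambda>n. norm (x n - scaleC_blinfun c id_blinfun)) \<longlongrightarrow> 0) \<alpha>))"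
proof -
  let ?R = "bounded_seq_ring A"
  let ?I = "null_seqs \<alpha> A"
  have I: "ideal ?I ?R"
    unfolding A_def by (rule ideal_null_seqs)
  then interpret R: ring ?R
    by (rule ideal.axioms(2))
  have car: "x \<in> carrier ?R \<longleftrightarrow> (\<forall>n. clinear (x n)) \<and> bounded (range x)" for x
    unfolding A_def by (rule bounded_seq_carrier)
  have const: "(\<lambda>n. a) \<in> carrier ?R" if "clinear a" for a
    using that by (simp add: car)
  have sc: "clinear (scaleC_blinfun c (id_blinfun :: 'h \<Rightarrow>\<^sub>L 'h))" for c
    by (simp add: clinear_def scaleC_blinfun.rep_eq scaleC_scaleC mult.commute)
  have mult: "x \<otimes>\<^bsub>?R\<^esub> y = (\<lambda>n. x n o\<^sub>L y n)" for x y
    by (simp add: A_def bounded_seq_ring_def bounded_operators_def)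
  have U: "carrier (ultrapower \<alpha> A) = (\<lambda>x. ?I +>\<^bsub>?R\<^esub> x) ` carrier ?R"
    by (auto simp: ultrapower_def FactRing_def A_RCOSETS_def')
  have eq: "?I +>\<^bsub>?R\<^esub> x = ?I +>\<^bsub>?R\<^esub> y \<longleftrightarrow> ((\<lambda>n. norm (x n - y n)) \<longlongrightarrow> 0) \<alpha>"
    if "x \<in> carrier ?R" "y \<in> carrier ?R" for x y
    using null_coset_eq_iff that unfolding A_def by blast
  have comm: "?I +>\<^bsub>?R\<^esub> x \<in> ultrapower_commutant \<alpha> A \<longleftrightarrow>
      (\<forall>a. clinear a \<longrightarrow> ((\<lambda>n. norm ((x n o\<^sub>L a) - (a o\<^sub>L x n))) \<longlongrightarrow> 0) \<alpha>)"
    if x: "x \<in> carrier ?R" for x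
  proof -
    have "(?I +>\<^bsub>?R\<^esub> x) \<otimes>\<^bsub>ultrapower \<alpha> A\<^esub> ultrapower_const \<alpha> A a =
        ultrapower_const \<alpha> A a \<otimes>\<^bsub>ultrapower \<alpha> A\<^esub> (?I +>\<^bsub>?R\<^esub> x) \<longleftrightarrow>
        ((\<lambda>n. norm ((x n o\<^sub>L a) - (a o\<^sub>L x n))) \<longlongrightarrow> 0) \<alpha>" if a: "clinear a" for a
    proof -
      have "(?I +>\<^bsub>?R\<^esub> x) \<otimes>\<^bsub>ultrapower \<alpha> A\<^esub> ultrapower_const \<alpha> A a = ?I +>\<^bsub>?R\<^esub> (x \<otimes>\<^bsub>?R\<^esub> (\<lambda>n. a))"
        "ultrapower_const \<alpha> A a \<otimes>\<^bsub>ultrapower \<alpha> A\<^esub> (?I +>\<^bsub>?R\<^esub> x) = ?I +>\<^bsub>?R\<^esub> ((\<lambda>n. a) \<otimes>\<^bsub>?R\<^esub> x)"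
        using ideal.rcoset_mult_add[OF I x const[OF a]] ideal.rcoset_mult_add[OF I const[OF a] x]
        by (simp_all add: ultrapower_def FactRing_def ultrapower_const_def)
      then show ?thesis
        using eq[OF R.m_closed[OF x const[OF a]] R.m_closed[OF const[OF a] x]] by (simp add: mult)
    qed
    moreover have "?I +>\<^bsub>?R\<^esub> x \<in> carrier (ultrapower \<alpha> A)"
      using x U by blast
    moreover have "a \<in> carrier A \<longleftrightarrow> clinear a" for a
      by (simp add: A_def clinear_carrier)
    ultimately show ?thesis
      by (auto simp: ultrapower_commutant_def)
  qed
  have scal: "?I +>\<^bsub>?R\<^esub> x \<in> ultrapower_scalars \<alpha> A \<longleftrightarrow>
      (\<exists>c. ((\<lambda>n. norm (x n - scaleC_blinfun c id_blinfun)) \<longlongrightarrow> 0) \<alpha>)"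
    if x: "x \<in> carrier ?R" for x
  proof -
    have "c \<odot>\<^bsub>A\<^esub> \<one>\<^bsub>A\<^esub> = scaleC_blinfun c id_blinfun" for c
      by (simp add: A_def bounded_operators_def)
    then show ?thesis
      using eq[OF x const[OF sc]] by (auto simp: ultrapower_scalars_def ultrapower_const_def)
  qed
  have sub: "ultrapower_scalars \<alpha> A \<subseteq> ultrapower_commutant \<alpha> A"
  proof
    fix z assume z: "z \<in> ultrapower_scalars \<alpha> A"
    then obtain c where c: "z = ?I +>\<^bsub>?R\<^esub> (\<lambda>n. scaleC_blinfun c id_blinfun)"
      by (auto simp: ultrapower_scalars_def ultrapower_const_def A_def bounded_operators_def)
    have "(scaleC_blinfun c id_blinfun o\<^sub>L a) - (a o\<^sub>L scaleC_blinfun c id_blinfun) = 0"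
      if "clinear a" for a :: "'h \<Rightarrow>\<^sub>L 'h"
      using that by (intro blinfun_eqI) (simp add: clinear_def scaleC_blinfun.rep_eq blinfun.diff_left)
    then show "z \<in> ultrapower_commutant \<alpha> A"
      unfolding c by (subst comm[OF const[OF sc]]) simp
  qed
  have "ultrapower_commutant \<alpha> A \<noteq> ultrapower_scalars \<alpha> A \<longleftrightarrow>
      (\<exists>x\<in>carrier ?R. ?I +>\<^bsub>?R\<^esub> x \<in> ultrapower_commutant \<alpha> A \<and> ?I +>\<^bsub>?R\<^esub> x \<notin> ultrapower_scalars \<alpha> A)"
  proof -
    have "ultrapower_commutant \<alpha> A \<subseteq> (\<lambda>x. ?I +>\<^bsub>?R\<^esub> x) ` carrier ?R"
      using U by (auto simp: ultrapower_commutant_def)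
    then show ?thesis
      using sub by blast
  qed
  also have "\<dots> \<longleftrightarrow> (\<exists>x\<in>carrier ?R.
      (\<forall>a. clinear a \<longrightarrow> ((\<lambda>n. norm ((x n o\<^sub>L a) - (a o\<^sub>L x n))) \<longlongrightarrow> 0) \<alpha>) \<and>
      \<not> (\<exists>c. ((\<lambda>n. norm (x n - scaleC_blinfun c id_blinfun)) \<longlongrightarrow> 0) \<alpha>))"
    using comm scal by (intro bex_cong) auto
  finally show ?thesis
    unfolding car Bex_def by (simp only: conj_assoc)
qed

section \<open>Oscillation\<close>

text \<open>\<open>Max\<close> is informative on finite sets only; both indices lie below the end of
  the block.\<close>

lemma finite_block_differences:
  fixes f :: "nat \<Rightarrow> nat" and x :: "nat \<Rightarrow> real"
  shows "finite {\<bar>x i - x j\<bar> | i j. (f ^^ k) 0 \<le> i \<and> i \<le> j \<and> j < (f ^^ Suc k) 0}"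
  (is "finite ?D")
proof (rule finite_subset)
  let ?n = "(f ^^ Suc k) 0"
  show "?D \<subseteq> (\<lambda>(i, j). \<bar>x i - x j\<bar>) ` ({..<?n} \<times> {..<?n})"
  proof clarify
    fix i j assume ij: "i \<le> j" "j < (f ^^ Suc k) 0"
    then have "i < (f ^^ Suc k) 0"
      by (rule le_less_trans)
    with ij show "\<bar>x i - x j\<bar> \<in> (\<lambda>(i, j). \<bar>x i - x j\<bar>) ` ({..<?n} \<times> {..<?n})"
      by (intro image_eqI[of _ _ "(i, j)"]) (simp_all del: funpow.simps)
  qed
qed simp

lemma block_oscillation_le:
  assumes "0 \<le> B"
    and "\<And>i j. (f ^^ k) 0 \<le> i \<Longrightarrow> i \<le> j \<Longrightarrow> j < (f ^^ Suc k) 0 \<Longrightarrow> \<bar>x i - x j\<bar> \<le> B"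
  shows "block_oscillation f k x \<le> B"
  unfolding block_oscillation_def using assms finite_block_differences[of x k f]
  by (subst Max_le_iff) (auto simp del: funpow.simps)

lemma block_oscillation_upper:
  assumes "(f ^^ k) 0 \<le> i" "i \<le> j" "j < (f ^^ Suc k) 0"
  shows "\<bar>x i - x j\<bar> \<le> block_oscillation f k x"
  unfolding block_oscillation_def using assms finite_block_differences[of x k f]
  by (intro Max_ge) (auto simp del: funpow.simps)

lemma block_oscillation_nonneg: "0 \<le> block_oscillation f k x"
  unfolding block_oscillation_def using finite_block_differences[of x k f]
  by (intro Max_ge) (auto simp del: funpow.simps)

lemma oscillation_le:
  assumes "0 \<le> B"
    and "\<And>k i j. (f ^^ k) 0 \<le> i \<Longrightarrow> i \<le> j \<Longrightarrow> j < (f ^^ Suc k) 0 \<Longrightarrow> \<bar>x i - x j\<bar> \<le> B"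
  shows "oscillation f x \<le> B"
  unfolding oscillation_def using assms by (intro cSUP_least block_oscillation_le) auto

lemma block_oscillation_le_oscillation:
  assumes "\<And>i. x i \<in> {0..1}"
  shows "block_oscillation f k x \<le> oscillation f x"
  unfolding oscillation_def
proof (rule cSUP_upper)
  have "block_oscillation f k x \<le> 1" for k
  proof (rule block_oscillation_le)
    fix i j
    show "\<bar>x i - x j\<bar> \<le> 1"
      using assms[of i] assms[of j] by auto
  qed simp
  then show "bdd_above (range (\<lambda>k. block_oscillation f k x))"
    by (intro bdd_aboveI2[of _ _ 1])
qed simp

lemma oscillation_upper:
  assumes "\<And>i. x i \<in> {0..1}" "(f ^^ k) 0 \<le> i" "i \<le> j" "j < (f ^^ Suc k) 0"
  shows "\<bar>x i - x j\<bar> \<le> oscillation f x"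
  using block_oscillation_upper[OF assms(2-)] block_oscillation_le_oscillation[OF assms(1)]
  by (rule order_trans)

lemma oscillation_nonneg: "(\<And>i. x i \<in> {0..1}) \<Longrightarrow> 0 \<le> oscillation f x"
  using block_oscillation_nonneg block_oscillation_le_oscillation by (rule order_trans)

section \<open>A flatness scale from a nontrivial commutant\<close>

lemma flat_if_commutant_nontrivial:
  fixes e :: "nat \<Rightarrow> 'h::chilbert_space" and b :: "nat \<Rightarrow> 'h \<Rightarrow>\<^sub>L 'h"
  assumes \<alpha>: "nonprincipal_ultrafilter \<alpha>"
    and e: "orthonormal e" and basis: "closure (cspan (range e)) = UNIV"
    and b: "\<And>n. clinear (b n)" and bd: "bounded (range b)"
    and comm: "\<And>a. clinear a \<Longrightarrow> ((\<lambda>n. norm ((b n o\<^sub>L a) - (a o\<^sub>L b n))) \<longlongrightarrow> 0) \<alpha>"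
    and nonscalar: "\<not> (\<exists>c. ((\<lambda>n. norm (b n - scaleC_blinfun c id_blinfun)) \<longlongrightarrow> 0) \<alpha>)"
  shows "flat \<alpha>"
proof -
  define E where "E n = (INF i. spread e (b n) i)" for n
  have E0: "0 \<le> E n" "E n \<le> spread e (b n) i" for n i
    unfolding E_def by (rule spread_INF_nonneg[OF e], rule spread_INF_le[OF e])
  have E: "(E \<longlongrightarrow> 0) \<alpha>"
  proof -
    obtain T where T: "clinear T"
      "\<And>n. E n \<le> norm ((b n o\<^sub>L T) - (T o\<^sub>L b n)) + inverse (real (Suc n))"
      using ex_operator_detecting_limit_spread[OF e, of b] unfolding E_def by blast
    have "((\<lambda>n. inverse (real (Suc n))) \<longlongrightarrow> 0) \<alpha>"
      using LIMSEQ_inverse_real_of_nat nonprincipal_ultrafilter_le_sequentially[OF \<alpha>]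
      by (rule tendsto_mono[rotated])
    with comm[OF T(1)] have "((\<lambda>n. norm ((b n o\<^sub>L T) - (T o\<^sub>L b n)) + inverse (real (Suc n))) \<longlongrightarrow> 0) \<alpha>"
      using tendsto_add by fastforce
    then show ?thesis
      by (rule tendsto_sandwich[rotated -2, OF tendsto_const]) (use E0 T in auto)
  qed
  obtain K where K: "K > 0" "\<And>n. norm (b n) \<le> K"
    using bd by (auto simp: bounded_pos)
  \<comment> \<open>Otherwise the values of the form at \<open>e 0\<close> have a limit c along
    \<alpha>, and \<open>b n\<close> differs from c by an operator tending to 0.\<close>
  have "\<not> ((\<lambda>n. spread e (b n) 0) \<longlongrightarrow> 0) \<alpha>"
  proof
    assume s: "((\<lambda>n. spread e (b n) 0) \<longlongrightarrow> 0) \<alpha>"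
    define l where "l n = cinner (b n (e 0)) (e 0)" for n
    have "cmod (l n) \<le> K" for n
      using cmod_numerical_le[OF orthonormal_norm[OF e], of "b n" 0] K(2)[of n] by (simp add: l_def)
    then have "bounded (range l)"
      by (auto simp: bounded_iff)
    then obtain c where c: "(l \<longlongrightarrow> c) \<alpha>"
      using ultrafilter_limit_exists[OF \<alpha>] by blast
    have le: "norm (b n - scaleC_blinfun c id_blinfun) \<le> 4 * spread e (b n) 0 + cmod (l n - c)" for n
    proof -
      have "b n - scaleC_blinfun c id_blinfun =
          (b n - scaleC_blinfun (l n) id_blinfun) + scaleC_blinfun (l n - c) id_blinfun"
        by (intro blinfun_eqI)
          (simp add: blinfun.diff_left blinfun.add_left scaleC_blinfun.rep_eq
            complex_vector.scale_left_diff_distrib)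
      also have "norm \<dots> \<le> norm (b n - scaleC_blinfun (l n) id_blinfun)
          + norm (scaleC_blinfun (l n - c) (id_blinfun :: 'h \<Rightarrow>\<^sub>L 'h))"
        by (rule norm_triangle_ineq)
      also have "\<dots> \<le> 4 * spread e (b n) 0 + cmod (l n - c)"
        unfolding l_def
        by (intro add_mono norm_diff_scalar_le_spread[OF e basis b] norm_blinfun_bound)
          (simp_all add: scaleC_blinfun.rep_eq norm_scaleC)
      finally show ?thesis .
    qed
    have "((\<lambda>n. 4 * spread e (b n) 0 + cmod (l n - c)) \<longlongrightarrow> 4 * 0 + cmod (c - c)) \<alpha>"
      by (intro tendsto_intros s c)
    then have "((\<lambda>n. 4 * spread e (b n) 0 + cmod (l n - c)) \<longlongrightarrow> 0) \<alpha>"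
      by simp
    then have "((\<lambda>n. norm (b n - scaleC_blinfun c id_blinfun)) \<longlongrightarrow> 0) \<alpha>"
      by (rule tendsto_sandwich[rotated -2, OF tendsto_const]) (use le in auto)
    then show False
      using nonscalar by blast
  qed
  then obtain r where r: "r > 0" "\<not> eventually (\<lambda>n. spread e (b n) 0 < r) \<alpha>"
    using spread_nonneg[OF e] by (auto simp: tendsto_iff)
  \<comment> \<open>Failure of convergence only denies that the spread is eventually below r. The
    ultrafilter turns this into a spread of at least r on a set in \<alpha>, where the limit spread
    is also below r / 2.\<close>
  define good where "good n \<longleftrightarrow> r \<le> spread e (b n) 0 \<and> E n < r / 2" for n
  have good: "eventually good \<alpha>"
  proof -
    have "eventually (\<lambda>n. \<not> spread e (b n) 0 < r) \<alpha>"
      by (rule ultrafilter_not_eventually[OF \<alpha> r(2)])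
    moreover have "eventually (\<lambda>n. E n < r / 2) \<alpha>"
      using E r(1) by (intro order_tendstoD) auto
    ultimately show ?thesis
      by eventually_elim (simp add: good_def)
  qed
  \<comment> \<open>The spread is at most 2 K, which normalizes the values to the unit interval. For
    the other n the sequence 1, 0, 0, ... meets the conditions on supremum and limit; its
    oscillation is irrelevant along \<alpha>.\<close>
  define s where "s n i = (if good n then (spread e (b n) i - E n) / (2 * K) else if i = 0 then 1 else 0)" for n i
  have s01: "s n i \<in> {0..1}" for n i
  proof -
    have "spread e (b n) i \<le> 2 * K"
      using spread_le[OF e, of "b n" i] K(2)[of n] by simp
    then show ?thesis
      using E0[of n] E0(2)[of n i] K(1) by (auto simp: s_def divide_simps)
  qed
  have decs: "s n j \<le> s n i" if "i \<le> j" for n i j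
    using spread_antimono[OF e that, of "b n"] K(1) that by (auto simp: s_def divide_right_mono)
  \<comment> \<open>For good n the drop is at least r / 2, divided by 2 K; the default sequence has
    supremum 1.\<close>
  define \<rho> where "\<rho> = min 1 (r / (4 * K))"
  have "(SUP i. s n i) \<ge> \<rho>" for n
  proof -
    have "\<rho> \<le> s n 0"
    proof (cases "good n")
      case True
      then have "r / 2 \<le> spread e (b n) 0 - E n"
        by (simp add: good_def)
      then have "r / 2 / (2 * K) \<le> s n 0"
        using K(1) True unfolding s_def by (simp add: divide_right_mono del: divide_divide_eq_left)
      then show ?thesis
        by (simp add: \<rho>_def min.coboundedI2)
    qed (simp add: s_def \<rho>_def)
    also have "s n 0 \<le> (SUP i. s n i)"
      using s01 by (intro cSUP_upper bdd_aboveI2[of _ _ 1]) auto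
    finally show ?thesis .
  qed
  moreover have "s n \<longlonglongrightarrow> 0" for n
  proof (cases "good n")
    case True
    have "(\<lambda>i. (spread e (b n) i - E n) / (2 * K)) \<longlonglongrightarrow> (E n - E n) / (2 * K)"
      unfolding E_def by (intro tendsto_intros spread_LIMSEQ[OF e]) (use K in auto)
    moreover have "s n = (\<lambda>i. (spread e (b n) i - E n) / (2 * K))"
      using True by (simp add: s_def fun_eq_iff)
    ultimately show ?thesis
      by simp
  next
    case False
    have "eventually (\<lambda>i. s n i = 0) sequentially"
      using eventually_gt_at_top[of 0] by eventually_elim (simp add: s_def False)
    then show ?thesis
      by (rule tendsto_eventually)
  qed
  moreover have "\<rho> > 0"
    using r K by (simp add: \<rho>_def)
  moreover have "((\<lambda>n. oscillation f (s n)) \<longlongrightarrow> 0) \<alpha>" if f: "strict_mono f" for f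
  proof -
    define T where "T = frame_op (\<lambda>i. 1) e (\<lambda>i. e (f i))"
    let ?c = "\<lambda>n. norm ((b n o\<^sub>L T) - (T o\<^sub>L b n))"
    have T: "clinear T"
      unfolding T_def
      by (rule clinear_frame_op[OF e orthonormal_comp[OF e strict_mono_imp_inj_on[OF f]], of _ 1]) simp
    have "oscillation f (s n) \<le> ?c n / K" if g: "good n" for n
    proof (rule oscillation_le)
      fix k i j assume k: "(f ^^ k) 0 \<le> i" "i \<le> j" "j < (f ^^ Suc k) 0"
      \<comment> \<open>The block ends at \<open>f ((f ^^ k) 0)\<close>, which is at most f
        i.\<close>
      then have "j \<le> f i"
        using f by (simp add: strict_mono_less_eq[symmetric, of f "(f ^^ k) 0" i])
      then have "\<bar>s n i - s n j\<bar> \<le> s n i - s n (f i)"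
        using decs[OF k(2), of n] decs[of j "f i" n] by simp
      also have "\<dots> = (spread e (b n) i - spread e (b n) (f i)) / (2 * K)"
        using g by (simp add: s_def diff_divide_distrib)
      also have "\<dots> \<le> (2 * ?c n) / (2 * K)"
        using spread_shift[OF e f, of "b n" i] K(1) by (intro divide_right_mono) (auto simp: T_def)
      finally show "\<bar>s n i - s n j\<bar> \<le> ?c n / K"
        by simp
    qed (use K in simp)
    then have le: "eventually (\<lambda>n. oscillation f (s n) \<le> ?c n / K) \<alpha>"
      using good by (rule eventually_mono[rotated])
    have "((\<lambda>n. ?c n / K) \<longlongrightarrow> 0 / K) \<alpha>"
      by (intro tendsto_divide comm T tendsto_const) (use K in simp)
    then have lim: "((\<lambda>n. ?c n / K) \<longlongrightarrow> 0) \<alpha>"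
      by simp
    have ge: "eventually (\<lambda>n. 0 \<le> oscillation f (s n)) \<alpha>"
      using s01 by (intro always_eventually allI oscillation_nonneg)
    show ?thesis
      by (rule tendsto_sandwich[OF ge le tendsto_const lim])
  qed
  ultimately have "flatness_scale \<alpha> s"
    using s01 unfolding flatness_scale_def by blast
  then show ?thesis
    unfolding flat_def by blast
qed

section \<open>Commutators with diagonal operators\<close>

lemma functional_sum:
  fixes \<phi> :: "'h::chilbert_space \<Rightarrow> complex"
  assumes "\<And>x y. \<phi> (x + y) = \<phi> x + \<phi> y" "\<And>c x. \<phi> (c *\<^sub>C x) = c * \<phi> x"
  shows "\<phi> (\<Sum>i\<in>A. c i *\<^sub>C v i) = (\<Sum>i\<in>A. c i * \<phi> (v i))"
proof -
  have "\<phi> 0 = 0"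
    using assms(2)[of 0 0] by simp
  then show ?thesis
    by (induction A rule: infinite_finite_induct) (simp_all add: assms)
qed

lemma cspan_atLeast_sum:
  assumes e: "orthonormal e" and x: "x \<in> cspan (e ` {N..})"
  shows "\<exists>n. x = oproj e {N..<n} x"
proof -
  have "x \<in> cspan (range e)"
    using x complex_vector.span_mono[of "e ` {N..}" "range e"] by auto
  then obtain n where n: "x \<in> cspan (e ` {..<n})"
    using cspan_image_lessThan by blast
  have "cinner x (e i) = 0" if "i < N" for i
    by (intro cspan_orthogonal[OF x]) (use that in \<open>auto simp: orthonormal_cinner[OF e]\<close>)
  then have "oproj e {..<n} x = oproj e {N..<n} x"
    unfolding oproj_def by (intro sum.mono_neutral_right) auto
  then show ?thesis
    using oproj_eq[OF e _ n] by auto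
qed

text \<open>Bounded functionals are represented on finite sets of basis vectors by inner products, so
  their values on the basis are square summable.\<close>

lemma functional_tail:
  fixes \<phi> :: "'h::chilbert_space \<Rightarrow> complex"
  assumes e: "orthonormal e"
    and \<phi>: "\<And>x y. \<phi> (x + y) = \<phi> x + \<phi> y" "\<And>c x. \<phi> (c *\<^sub>C x) = c * \<phi> x" "\<And>x. cmod (\<phi> x) \<le> C * norm x"
    and \<epsilon>: "\<epsilon> > 0"
  shows "\<exists>N. \<forall>x\<in>cspan (e ` {N..}). cmod (\<phi> x) \<le> \<epsilon> * norm x"
proof -
  \<comment> \<open>This vector represents \<phi> on the span of the basis vectors in A. Evaluating
    \<phi> at it gives the square of its norm, so the bound C on \<phi> bounds its norm uniformly in
    A.\<close>
  define y where "y A = (\<Sum>i\<in>A. cnj (\<phi> (e i)) *\<^sub>C e i)" for A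
  have ny: "(norm (y A))\<^sup>2 = (\<Sum>i\<in>A. (cmod (\<phi> (e i)))\<^sup>2)" if "finite A" for A
    unfolding y_def by (subst orthonormal_norm_sum[OF e that]) simp
  have y\<phi>: "\<phi> (y A) = complex_of_real ((norm (y A))\<^sup>2)" if "finite A" for A
  proof -
    have "\<phi> (y A) = (\<Sum>i\<in>A. cnj (\<phi> (e i)) * \<phi> (e i))"
      unfolding y_def by (rule functional_sum[OF \<phi>(1,2)])
    also have "\<dots> = complex_of_real (\<Sum>i\<in>A. (cmod (\<phi> (e i)))\<^sup>2)"
      unfolding of_real_sum by (intro sum.cong refl) (simp only: complex_norm_square mult.commute)
    finally show ?thesis
      by (simp only: ny[OF that])
  qed
  have "summable (\<lambda>i. (cmod (\<phi> (e i)))\<^sup>2)"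
  proof (rule summableI_nonneg_bounded)
    fix n
    have "(norm (y {..<n}))\<^sup>2 \<le> C * norm (y {..<n})"
      using \<phi>(3)[of "y {..<n}"] y\<phi>[of "{..<n}"] by (simp add: norm_power)
    then have "norm (y {..<n}) \<le> \<bar>C\<bar>"
      by (cases "y {..<n} = 0") (auto simp: power2_eq_square)
    then have "(norm (y {..<n}))\<^sup>2 \<le> \<bar>C\<bar>\<^sup>2"
      by (rule power_mono) simp
    then show "(\<Sum>i<n. (cmod (\<phi> (e i)))\<^sup>2) \<le> C\<^sup>2"
      by (simp add: ny)
  qed simp
  then obtain N where N: "\<And>n. norm (\<Sum>i=N..<n. (cmod (\<phi> (e i)))\<^sup>2) < \<epsilon>\<^sup>2"
    unfolding summable_Cauchy using \<epsilon> by (meson order_refl zero_less_power)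
  have "cmod (\<phi> x) \<le> \<epsilon> * norm x" if x: "x \<in> cspan (e ` {N..})" for x
  proof -
    obtain n where n: "x = oproj e {N..<n} x"
      using cspan_atLeast_sum[OF e x] by blast
    have "\<phi> x = (\<Sum>i=N..<n. cinner x (e i) * \<phi> (e i))"
      by (subst n) (simp add: oproj_def functional_sum[OF \<phi>(1,2)])
    also have "\<dots> = cinner x (y {N..<n})"
      by (simp add: y_def cinner.sum_right cinner_scaleC_right mult.commute)
    finally have "cmod (\<phi> x) \<le> norm x * norm (y {N..<n})"
      using Cauchy_Schwarz_cinner by simp
    also have "norm (y {N..<n}) \<le> \<epsilon>"
    proof (rule power2_le_imp_le)
      show "(norm (y {N..<n}))\<^sup>2 \<le> \<epsilon>\<^sup>2"
        using N[of n] by (simp add: ny)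
    qed (use \<epsilon> in simp)
    then have "norm x * norm (y {N..<n}) \<le> norm x * \<epsilon>"
      by (rule mult_left_mono) simp
    finally show ?thesis
      by (simp add: mult.commute)
  qed
  then show ?thesis
    by blast
qed

text \<open>Each of the m coordinates of u is at most \<open>norm u\<close>. The crude factor m does
  no harm, since \<delta> is chosen after m.\<close>

lemma functional_head:
  fixes \<psi> :: "'h::chilbert_space \<Rightarrow> complex"
  assumes e: "orthonormal e"
    and \<psi>: "\<And>x y. \<psi> (x + y) = \<psi> x + \<psi> y" "\<And>c x. \<psi> (c *\<^sub>C x) = c * \<psi> x"
    and \<delta>: "\<And>i. i < m \<Longrightarrow> cmod (\<psi> (e i)) \<le> \<delta>"
    and u: "u \<in> cspan (e ` {..<m})"
  shows "cmod (\<psi> u) \<le> real m * \<delta> * norm u"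
proof -
  have "\<psi> u = \<psi> (oproj e {..<m} u)"
    using oproj_eq[OF e _ u] by simp
  also have "\<dots> = (\<Sum>i<m. cinner u (e i) * \<psi> (e i))"
    unfolding oproj_def by (rule functional_sum[OF \<psi>])
  also have "cmod \<dots> \<le> (\<Sum>i<m. norm u * \<delta>)"
  proof (rule sum_norm_le)
    fix i assume "i \<in> {..<m}"
    moreover have "cmod (cinner u (e i)) \<le> norm u"
      using Cauchy_Schwarz_cinner[of u "e i"] by (simp add: orthonormal_norm[OF e])
    ultimately show "cmod (cinner u (e i) * \<psi> (e i)) \<le> norm u * \<delta>"
      unfolding norm_mult using \<delta> by (intro mult_mono) auto
  qed
  finally show ?thesis
    by (simp add: mult_ac)
qed

text \<open>No adjoint is formed: for each i < m both \<open>cinner w (a (e i))\<close> and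
  \<open>cinner (a w) (e i)\<close> are bounded linear functionals of w, hence small on a far tail,
  and finitely many i share a common tail.\<close>

lemma operator_off_diagonal_small:
  fixes a :: "'h::chilbert_space \<Rightarrow>\<^sub>L 'h"
  assumes e: "orthonormal e" and a: "clinear a" and \<eta>: "\<eta> > 0"
  shows "\<exists>N. \<forall>u\<in>cspan (e ` {..<m}). \<forall>w\<in>cspan (e ` {N..}).
    cmod (cinner (a u) w) \<le> \<eta> * norm u * norm w \<and> cmod (cinner (a w) u) \<le> \<eta> * norm u * norm w"
proof -
  define \<delta> where "\<delta> = \<eta> / real (Suc m)"
  have \<delta>: "\<delta> > 0" "real m * \<delta> \<le> \<eta>"
    using \<eta> by (auto simp: \<delta>_def divide_simps)
  have al: "a (c *\<^sub>C x) = c *\<^sub>C a x" for c x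
    using a by (simp add: clinear_def)
  have "\<exists>N. \<forall>w\<in>cspan (e ` {N..}). cmod (cinner w (a (e i))) \<le> \<delta> * norm w \<and> cmod (cinner (a w) (e i)) \<le> \<delta> * norm w" for i
  proof -
    have "\<exists>N. \<forall>w\<in>cspan (e ` {N..}). cmod (cinner w (a (e i))) \<le> \<delta> * norm w"
      by (rule functional_tail[OF e _ _ _ \<delta>(1), of _ "norm (a (e i))"])
        (auto simp: cinner_add_left cinner_scaleC_left mult.commute[of "norm (a (e i))"] Cauchy_Schwarz_cinner)
    moreover have "\<exists>N. \<forall>w\<in>cspan (e ` {N..}). cmod (cinner (a w) (e i)) \<le> \<delta> * norm w"
    proof (rule functional_tail[OF e _ _ _ \<delta>(1), of _ "norm a"])
      fix x
      have "cmod (cinner (a x) (e i)) \<le> norm (a x) * norm (e i)"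
        by (rule Cauchy_Schwarz_cinner)
      also have "\<dots> \<le> norm a * norm x"
        using norm_blinfun[of a x] by (simp add: orthonormal_norm[OF e])
      finally show "cmod (cinner (a x) (e i)) \<le> norm a * norm x" .
    qed (simp_all add: blinfun.add_right al cinner_add_left cinner_scaleC_left)
    ultimately obtain N1 N2 where "\<And>w. w \<in> cspan (e ` {N1..}) \<Longrightarrow> cmod (cinner w (a (e i))) \<le> \<delta> * norm w"
      "\<And>w. w \<in> cspan (e ` {N2..}) \<Longrightarrow> cmod (cinner (a w) (e i)) \<le> \<delta> * norm w"
      by blast
    then show ?thesis
      using complex_vector.span_mono[OF image_mono, of "{max N1 N2..}" "{N1..}" e]
        complex_vector.span_mono[OF image_mono, of "{max N1 N2..}" "{N2..}" e]
      by (intro exI[of _ "max N1 N2"]) auto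
  qed
  then obtain N where N: "\<And>i w. w \<in> cspan (e ` {N i..}) \<Longrightarrow>
      cmod (cinner w (a (e i))) \<le> \<delta> * norm w \<and> cmod (cinner (a w) (e i)) \<le> \<delta> * norm w"
    by metis
  define L where "L = Max (insert 0 (N ` {..<m}))"
  show ?thesis
  proof (intro exI[of _ L] ballI)
    fix u w assume u: "u \<in> cspan (e ` {..<m})" and w: "w \<in> cspan (e ` {L..})"
    have small: "cmod (cinner w (a (e i))) \<le> \<delta> * norm w" "cmod (cinner (a w) (e i)) \<le> \<delta> * norm w"
      if "i < m" for i
    proof -
      have "N i \<le> L"
        unfolding L_def using that by (intro Max_ge) auto
      then have "w \<in> cspan (e ` {N i..})"
        using w complex_vector.span_mono[OF image_mono, of "{L..}" "{N i..}" e] by auto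
      then show "cmod (cinner w (a (e i))) \<le> \<delta> * norm w" "cmod (cinner (a w) (e i)) \<le> \<delta> * norm w"
        using N by auto
    qed
    have "cmod (cinner (a u) w) \<le> real m * (\<delta> * norm w) * norm u"
    proof (rule functional_head[OF e _ _ _ u])
      show "cmod (cinner (a (e i)) w) \<le> \<delta> * norm w" if "i < m" for i
        using small(1)[OF that] by (subst cinner_commute) simp
    qed (simp_all add: blinfun.add_right al cinner_add_left cinner_scaleC_left)
    moreover have "cmod (cinner u (a w)) \<le> real m * (\<delta> * norm w) * norm u"
    proof (rule functional_head[OF e _ _ _ u])
      show "cmod (cinner (e i) (a w)) \<le> \<delta> * norm w" if "i < m" for i
        using small(2)[OF that] by (subst cinner_commute) simp
    qed (simp_all add: cinner_add_left cinner_scaleC_left)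
    moreover have "cmod (cinner (a w) u) = cmod (cinner u (a w))"
      by (subst cinner_commute) simp
    moreover have "real m * (\<delta> * norm w) * norm u \<le> \<eta> * norm u * norm w"
      using mult_right_mono[OF \<delta>(2), of "norm u * norm w"] by (simp add: mult_ac)
    ultimately show "cmod (cinner (a u) w) \<le> \<eta> * norm u * norm w \<and> cmod (cinner (a w) u) \<le> \<eta> * norm u * norm w"
      by linarith
  qed
qed

text \<open>Iterating f from 0 will give the block boundaries. The geometric weights make the errors
  summable over all pairs of blocks.\<close>

lemma ex_block_function:
  fixes a :: "'h::chilbert_space \<Rightarrow>\<^sub>L 'h"
  assumes e: "orthonormal e" and a: "clinear a" and \<tau>: "\<tau> > 0"
  shows "\<exists>f :: nat \<Rightarrow> nat. strict_mono f \<and> (\<forall>m. m < f m) \<and>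
    (\<forall>m. \<forall>u\<in>cspan (e ` {..<m}). \<forall>w\<in>cspan (e ` {f m..}).
      cmod (cinner (a u) w) \<le> \<tau> * (1/4) ^ Suc m * norm u * norm w \<and>
      cmod (cinner (a w) u) \<le> \<tau> * (1/4) ^ Suc m * norm u * norm w)"
proof -
  have "\<exists>N. \<forall>u\<in>cspan (e ` {..<m}). \<forall>w\<in>cspan (e ` {N..}).
      cmod (cinner (a u) w) \<le> \<tau> * (1/4) ^ Suc m * norm u * norm w \<and>
      cmod (cinner (a w) u) \<le> \<tau> * (1/4) ^ Suc m * norm u * norm w" for m
    using \<tau> by (intro operator_off_diagonal_small[OF e a]) simp
  then obtain N where N: "\<And>m u w. u \<in> cspan (e ` {..<m}) \<Longrightarrow> w \<in> cspan (e ` {N m..}) \<Longrightarrow>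
      cmod (cinner (a u) w) \<le> \<tau> * (1/4) ^ Suc m * norm u * norm w \<and>
      cmod (cinner (a w) u) \<le> \<tau> * (1/4) ^ Suc m * norm u * norm w"
    by metis
  \<comment> \<open>Cumulative sums of successors make f strictly increasing, larger than the
    identity and at least N.\<close>
  define f where "f m = (\<Sum>i\<le>m. Suc (N i))" for m
  have "strict_mono f"
    by (simp add: strict_mono_Suc_iff f_def)
  moreover have "m < f m" for m
    by (induction m) (simp_all add: f_def)
  moreover have "N m \<le> f m" for m
    by (cases m) (simp_all add: f_def)
  then have "cspan (e ` {f m..}) \<subseteq> cspan (e ` {N m..})" for m
    by (intro complex_vector.span_mono image_mono) auto
  then have "\<forall>u\<in>cspan (e ` {..<m}). \<forall>w\<in>cspan (e ` {f m..}).
      cmod (cinner (a u) w) \<le> \<tau> * (1/4) ^ Suc m * norm u * norm w \<and>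
      cmod (cinner (a w) u) \<le> \<tau> * (1/4) ^ Suc m * norm u * norm w" for m
    using N by blast
  ultimately show ?thesis
    by (intro exI[of _ f]) blast
qed

lemma sum_consecutive_blocks:
  fixes g :: "nat \<Rightarrow> 'b::comm_monoid_add"
  assumes "mono n" "n 0 = 0"
  shows "(\<Sum>k<K. sum g {n k..<n (Suc k)}) = sum g {..<n K :: nat}"
proof (induction K)
  case (Suc K)
  have "n K \<le> n (Suc K)"
    using monoD[OF assms(1), of K "Suc K"] by simp
  then show ?case
    using Suc sum.atLeastLessThan_concat[of 0 "n K" "n (Suc K)" g] by (simp add: lessThan_atLeast0)
qed (simp add: assms)

section \<open>Diagonal operators and their commutators\<close>

definition diag_op :: "(nat \<Rightarrow> 'a::chilbert_space) \<Rightarrow> (nat \<Rightarrow> real) \<Rightarrow> 'a \<Rightarrow>\<^sub>L 'a" where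
  "diag_op e s = frame_op (\<lambda>i. complex_of_real (s i)) e e"

context
  fixes e :: "nat \<Rightarrow> 'h::chilbert_space" and s :: "nat \<Rightarrow> real"
  assumes e: "orthonormal e" and s: "\<And>i. s i \<in> {0..1}"
begin

lemma diag_coeff_le: "cmod (complex_of_real (s i)) \<le> 1"
  using s[of i] by simp

lemma clinear_diag_op: "clinear (diag_op e s)"
  unfolding diag_op_def by (rule clinear_frame_op[OF e e diag_coeff_le])

lemma norm_diag_op: "norm (diag_op e s) \<le> 1"
  unfolding diag_op_def by (rule norm_frame_op[OF e e diag_coeff_le])

lemma norm_diag_op_apply: "norm (diag_op e s x) \<le> norm x"
  unfolding diag_op_def
  by (rule order_trans[OF norm_frame_op_apply[OF e e diag_coeff_le]]) simp

lemma diag_op_basis: "diag_op e s (e i) = complex_of_real (s i) *\<^sub>C e i"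
  unfolding diag_op_def by (rule frame_op_basis[OF e e diag_coeff_le])

lemma diag_op_cspan: "x \<in> cspan (e ` A) \<Longrightarrow> diag_op e s x \<in> cspan (e ` A)"
  unfolding diag_op_def by (rule frame_op_cspan[OF e e diag_coeff_le])

lemma diag_op_symmetric:
  assumes "y \<in> cspan (range e)"
  shows "cinner (diag_op e s x) y = cinner x (diag_op e s y)"
  using assms
proof (induction rule: complex_vector.span_induct_alt)
  case (step c b y)
  then obtain j where j: "b = e j"
    by auto
  have l: "diag_op e s (c *\<^sub>C z) = c *\<^sub>C diag_op e s z" for z
    using clinear_diag_op by (simp add: clinear_def)
  have "cinner (diag_op e s x) (e j) = complex_of_real (s j) * cinner x (e j)"
    unfolding diag_op_def by (rule cinner_frame_op[OF e e diag_coeff_le])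
  then show ?case
    by (simp add: j cinner_add_right cinner_scaleC_right blinfun.add_right l diag_op_basis step)
qed (simp add: blinfun.zero_right)

lemma diag_op_near_scalar:
  assumes A: "finite A" and x: "x \<in> cspan (e ` A)" and \<delta>: "0 \<le> \<delta>" "\<And>i. i \<in> A \<Longrightarrow> \<bar>s i - c\<bar> \<le> \<delta>"
  shows "norm (diag_op e s x - complex_of_real c *\<^sub>C x) \<le> \<delta> * norm x"
proof (rule power2_le_imp_le)
  have l: "diag_op e s (d *\<^sub>C z) = d *\<^sub>C diag_op e s z" for d z
    using clinear_diag_op by (simp add: clinear_def)
  have ox: "oproj e A x = x"
    by (rule oproj_eq[OF e A x])
  have "diag_op e s x - complex_of_real c *\<^sub>C x =
      diag_op e s (oproj e A x) - complex_of_real c *\<^sub>C oproj e A x"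
    by (simp only: ox)
  also have "\<dots> = (\<Sum>i\<in>A. (complex_of_real (s i - c) * cinner x (e i)) *\<^sub>C e i)"
  proof -
    have "diag_op e s (z *\<^sub>C e i) - complex_of_real c *\<^sub>C z *\<^sub>C e i = (complex_of_real (s i - c) * z) *\<^sub>C e i" for z i
      by (simp only: l diag_op_basis scaleC_scaleC of_real_diff left_diff_distrib
          complex_vector.scale_left_diff_distrib mult.commute[of z])
    then show ?thesis
      by (simp only: oproj_def blinfun.sum_right complex_vector.scale_sum_right sum_subtractf[symmetric])
  qed
  finally have "(norm (diag_op e s x - complex_of_real c *\<^sub>C x))\<^sup>2 =
      (\<Sum>i\<in>A. (cmod (complex_of_real (s i - c) * cinner x (e i)))\<^sup>2)"
    by (simp only: orthonormal_norm_sum[OF e A])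
  also have "\<dots> \<le> (\<Sum>i\<in>A. \<delta>\<^sup>2 * (cmod (cinner x (e i)))\<^sup>2)"
  proof (rule sum_mono)
    fix i assume "i \<in> A"
    then have "\<bar>s i - c\<bar>\<^sup>2 \<le> \<delta>\<^sup>2"
      using \<delta> by (intro power_mono) auto
    then show "(cmod (complex_of_real (s i - c) * cinner x (e i)))\<^sup>2 \<le> \<delta>\<^sup>2 * (cmod (cinner x (e i)))\<^sup>2"
      unfolding norm_mult norm_of_real power_mult_distrib by (rule mult_right_mono) simp
  qed
  also have "\<dots> = (\<delta> * norm x)\<^sup>2"
    using norm_oproj[OF e A, of x] by (simp add: ox sum_distrib_left power_mult_distrib)
  finally show "(norm (diag_op e s x - complex_of_real c *\<^sub>C x))\<^sup>2 \<le> (\<delta> * norm x)\<^sup>2" .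
qed (use \<delta> in simp)

text \<open>The diagonal operator is within \<delta> of the scalar c on the first span and of d on
  the second. Replacing it by these scalars leaves two errors and the term with d - c, each at most
  \<delta> times \<open>norm a\<close>.\<close>

lemma commutator_near_term:
  fixes a :: "'h \<Rightarrow>\<^sub>L 'h"
  assumes a: "clinear a" and A: "finite A" "finite B" and x: "x \<in> cspan (e ` A)" and y: "y \<in> cspan (e ` B)"
    and \<delta>: "0 \<le> \<delta>" "\<And>i. i \<in> A \<Longrightarrow> \<bar>s i - c\<bar> \<le> \<delta>" "\<And>i. i \<in> B \<Longrightarrow> \<bar>s i - d\<bar> \<le> \<delta>" "\<bar>d - c\<bar> \<le> \<delta>"
  shows "cmod (cinner (((diag_op e s o\<^sub>L a) - (a o\<^sub>L diag_op e s)) x) y) \<le> 3 * \<delta> * norm a * (norm x * norm y)"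
proof -
  let ?h = "diag_op e s"
  let ?p = "?h y - complex_of_real d *\<^sub>C y"
  let ?q = "?h x - complex_of_real c *\<^sub>C x"
  have y': "y \<in> cspan (range e)"
    using y complex_vector.span_mono[of "e ` B" "range e"] by auto
  have al: "a (z *\<^sub>C x) = z *\<^sub>C a x" for z x
    using a by (simp add: clinear_def)
  have "cinner (((?h o\<^sub>L a) - (a o\<^sub>L ?h)) x) y = cinner (a x) (?h y) - cinner (a (?h x)) y"
    by (simp add: blinfun.diff_left cinner_diff_left diag_op_symmetric[OF y'])
  also have "\<dots> = cinner (a x) ?p - cinner (a ?q) y + complex_of_real (d - c) * cinner (a x) y"
    by (simp add: blinfun.diff_right al cinner_diff_left cinner_diff_right cinner_scaleC_left
        cinner_scaleC_right algebra_simps)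
  also have "cmod \<dots> \<le> cmod (cinner (a x) ?p) + cmod (cinner (a ?q) y)
      + cmod (complex_of_real (d - c) * cinner (a x) y)"
    by (meson add_mono norm_triangle_ineq norm_triangle_ineq4 order_refl order_trans)
  also have "\<dots> \<le> \<delta> * norm a * (norm x * norm y) + \<delta> * norm a * (norm x * norm y) + \<delta> * norm a * (norm x * norm y)"
  proof (intro add_mono)
    have ax: "norm (a z) \<le> norm a * norm z" for z
      by (rule norm_blinfun)
    have "cmod (cinner (a x) ?p) \<le> norm (a x) * norm ?p"
      by (rule Cauchy_Schwarz_cinner)
    also have "\<dots> \<le> (norm a * norm x) * (\<delta> * norm y)"
      by (intro mult_mono ax diag_op_near_scalar[OF A(2) y] \<delta>) auto
    finally show "cmod (cinner (a x) ?p) \<le> \<delta> * norm a * (norm x * norm y)"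
      by (simp add: mult_ac)
    have "cmod (cinner (a ?q) y) \<le> norm (a ?q) * norm y"
      by (rule Cauchy_Schwarz_cinner)
    also have "\<dots> \<le> (norm a * (\<delta> * norm x)) * norm y"
      by (intro mult_right_mono order_trans[OF ax] mult_left_mono diag_op_near_scalar[OF A(1) x] \<delta>) auto
    finally show "cmod (cinner (a ?q) y) \<le> \<delta> * norm a * (norm x * norm y)"
      by (simp add: mult_ac)
    have "cmod (complex_of_real (d - c) * cinner (a x) y) = \<bar>d - c\<bar> * cmod (cinner (a x) y)"
      unfolding norm_mult norm_of_real ..
    also have "cmod (cinner (a x) y) \<le> norm a * norm x * norm y"
      by (rule order_trans[OF Cauchy_Schwarz_cinner]) (intro mult_right_mono ax, simp)
    then have "\<bar>d - c\<bar> * cmod (cinner (a x) y) \<le> \<delta> * (norm a * norm x * norm y)"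
      by (intro mult_mono \<delta>) auto
    finally show "cmod (complex_of_real (d - c) * cinner (a x) y) \<le> \<delta> * norm a * (norm x * norm y)"
      by (simp add: mult_ac)
  qed
  finally show ?thesis
    by (simp add: mult_ac)
qed

text \<open>A diagonal operator is a contraction preserving spans of basis vectors, so the bound t
  applies to both halves of the commutator.\<close>

lemma commutator_far_term:
  fixes a :: "'h \<Rightarrow>\<^sub>L 'h"
  assumes x: "x \<in> cspan (e ` A)" and y: "y \<in> cspan (e ` B)" and t: "0 \<le> t"
    and far: "\<And>u w. u \<in> cspan (e ` A) \<Longrightarrow> w \<in> cspan (e ` B) \<Longrightarrow> cmod (cinner (a u) w) \<le> t * norm u * norm w"
  shows "cmod (cinner (((diag_op e s o\<^sub>L a) - (a o\<^sub>L diag_op e s)) x) y) \<le> 2 * t * (norm x * norm y)"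
proof -
  let ?h = "diag_op e s"
  have y': "y \<in> cspan (range e)"
    using y complex_vector.span_mono[of "e ` B" "range e"] by auto
  have "cinner (((?h o\<^sub>L a) - (a o\<^sub>L ?h)) x) y = cinner (a x) (?h y) - cinner (a (?h x)) y"
    by (simp add: blinfun.diff_left cinner_diff_left diag_op_symmetric[OF y'])
  also have "cmod \<dots> \<le> cmod (cinner (a x) (?h y)) + cmod (cinner (a (?h x)) y)"
    by (rule norm_triangle_ineq4)
  also have "\<dots> \<le> t * norm x * norm (?h y) + t * norm (?h x) * norm y"
    by (intro add_mono far x y diag_op_cspan)
  also have "\<dots> \<le> t * norm x * norm y + t * norm x * norm y"
    by (intro add_mono mult_mono norm_diag_op_apply) (use t in auto)
  finally show ?thesis
    by (simp add: mult_ac)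
qed

text \<open>The commutator is cut into blocks. Near the diagonal of blocks the factor \<open>\<delta>\<close> comes from the
  slow variation of \<open>s\<close>, and orthogonality of the blocks makes the sum harmless; the remaining
  blocks are summably small because the operator has small entries there.\<close>

lemma norm_commutator_diag_op_le:
  fixes a :: "'h \<Rightarrow>\<^sub>L 'h" and n :: "nat \<Rightarrow> nat"
  assumes basis: "closure (cspan (range e)) = UNIV" and a: "clinear a"
    and n: "strict_mono n" "n 0 = 0" and \<delta>: "0 \<le> \<delta>" and \<tau>: "0 \<le> \<tau>"
    and near: "\<And>k i j. n k \<le> i \<Longrightarrow> i \<le> j \<Longrightarrow> j < n (k + 2) \<Longrightarrow> \<bar>s i - s j\<bar> \<le> \<delta>"
    and far: "\<And>k l u w. k + 2 \<le> l \<Longrightarrow> u \<in> cspan (e ` {n k..<n (Suc k)}) \<Longrightarrow> w \<in> cspan (e ` {n l..<n (Suc l)}) \<Longrightarrow>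
      cmod (cinner (a u) w) \<le> \<tau> * (1/2) ^ k * (1/2) ^ l * norm u * norm w \<and>
      cmod (cinner (a w) u) \<le> \<tau> * (1/2) ^ k * (1/2) ^ l * norm u * norm w"
  shows "norm ((diag_op e s o\<^sub>L a) - (a o\<^sub>L diag_op e s)) \<le> 9 * \<delta> * norm a + 8 * \<tau>"
proof (rule norm_cinner_bound_unit[OF _ basis])
  let ?h = "diag_op e s"
  let ?T = "(?h o\<^sub>L a) - (a o\<^sub>L ?h)"
  have mono: "mono n"
    using n(1) by (rule strict_mono_mono)
  show "clinear ?T"
    using a clinear_diag_op by (simp add: clinear_def blinfun.diff_left complex_vector.scale_right_diff_distrib)
  fix x y assume x: "x \<in> cspan (range e)" "norm x \<le> 1" and y: "y \<in> cspan (range e)" "norm y \<le> 1"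
  define Q where "Q k z = oproj e {n k..<n (Suc k)} z" for k z
  obtain N1 N2 where N: "x \<in> cspan (e ` {..<N1})" "y \<in> cspan (e ` {..<N2})"
    using cspan_image_lessThan x y by meson
  \<comment> \<open>Strict growth gives K \<le> n K, so the first K blocks cover the supports of x
    and y.\<close>
  define K where "K = max N1 N2"
  have nK: "K \<le> n K"
    using n(1) by (rule strict_mono_imp_increasing)
  have xy: "x \<in> cspan (e ` {..<n K})" "y \<in> cspan (e ` {..<n K})"
    using N complex_vector.span_mono[OF image_mono, of "{..<N1}" "{..<n K}" e]
      complex_vector.span_mono[OF image_mono, of "{..<N2}" "{..<n K}" e] nK
    by (auto simp: K_def)
  have Q: "(\<Sum>k<K. Q k z) = z" if "z \<in> cspan (e ` {..<n K})" for z
    using oproj_eq[OF e _ that] sum_consecutive_blocks[OF mono n(2), of "\<lambda>i. cinner z (e i) *\<^sub>C e i" K]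
    by (simp add: Q_def oproj_def)
  have nQ: "(\<Sum>k<K. (norm (Q k z))\<^sup>2) \<le> 1" if "norm z \<le> 1" for z
  proof -
    have "(\<Sum>k<K. (norm (Q k z))\<^sup>2) = (\<Sum>i<n K. (cmod (cinner z (e i)))\<^sup>2)"
      using sum_consecutive_blocks[OF mono n(2), of "\<lambda>i. (cmod (cinner z (e i)))\<^sup>2" K]
      by (simp add: Q_def norm_oproj[OF e])
    also have "\<dots> \<le> (norm z)\<^sup>2"
      by (rule Bessel[OF e]) simp
    also have "\<dots> \<le> 1"
      using that by (simp add: power_le_one)
    finally show ?thesis .
  qed
  have Q1: "norm (Q k z) \<le> 1" if "norm z \<le> 1" for k z
  proof -
    have "(norm (Q k z))\<^sup>2 \<le> (norm z)\<^sup>2"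
      unfolding Q_def norm_oproj[OF e finite_atLeastLessThan] by (rule Bessel[OF e]) simp
    then have "norm (Q k z) \<le> norm z"
      by (rule power2_le_imp_le) simp
    then show ?thesis
      using that by simp
  qed
  have Qin: "Q k z \<in> cspan (e ` {n k..<n (Suc k)})" for k z
    unfolding Q_def by (rule oproj_in_cspan) simp
  define adj where "adj l k \<longleftrightarrow> k \<le> Suc l \<and> l \<le> Suc k" for l k :: nat
  define X Y where "X l = norm (Q l x)" and "Y k = norm (Q k y)" for l k
  have XY: "0 \<le> X l" "X l \<le> 1" "0 \<le> Y l" "Y l \<le> 1" for l
    using Q1 x y by (auto simp: X_def Y_def)
  \<comment> \<open>The product X l * Y k is replaced by half the sum of the squares. Each square
    then occurs for at most three neighbours, and Bessel keeps the number of blocks K out of the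
    bound.\<close>
  let ?A = "\<lambda>l k. if adj l k then 3 * \<delta> * norm a / 2 * ((X l)\<^sup>2 + (Y k)\<^sup>2) else 0"
  let ?F = "\<lambda>l k. 2 * \<tau> * ((1/2) ^ l * (1/2) ^ k)"
  have block_term: "cmod (cinner (?T (Q l x)) (Q k y)) \<le> ?A l k + ?F l k" for l k
  proof (cases "adj l k")
    case True
    \<comment> \<open>Adjacent blocks share the window of two blocks starting at block
      \<open>min l k\<close>. The values of s at the left ends of the two blocks serve as the
      scalars c and d.\<close>
    have near': "\<bar>s i - s j\<bar> \<le> \<delta>" if "n (min l k) \<le> i" "n (min l k) \<le> j" "i < n (min l k + 2)" "j < n (min l k + 2)" for i j
      using near[of "min l k" i j] near[of "min l k" j i] that by (cases "i \<le> j") auto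
    have mm: "n (min l k) \<le> n l" "n (min l k) \<le> n k" "n (Suc l) \<le> n (min l k + 2)" "n (Suc k) \<le> n (min l k + 2)"
      using True by (auto intro!: monoD[OF mono] simp: adj_def)
    have lt: "n l < n (Suc l)" "n k < n (Suc k)"
      using n(1) by (simp_all add: strict_mono_Suc_iff)
    have "cmod (cinner (?T (Q l x)) (Q k y)) \<le> 3 * \<delta> * norm a * (X l * Y k)"
      unfolding X_def Y_def
      by (rule commutator_near_term[OF a _ _ Qin Qin \<delta>, of _ _ "s (n l)" "s (n k)"])
        (use mm lt in \<open>auto intro!: near'\<close>)
    also have "X l * Y k \<le> ((X l)\<^sup>2 + (Y k)\<^sup>2) / 2"
      using zero_le_power2[of "X l - Y k"] by (simp add: power2_diff)
    then have "3 * \<delta> * norm a * (X l * Y k) \<le> 3 * \<delta> * norm a * (((X l)\<^sup>2 + (Y k)\<^sup>2) / 2)"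
      using \<delta> by (intro mult_left_mono) auto
    also have "\<dots> \<le> ?A l k + ?F l k"
      using True \<tau> by simp
    finally show ?thesis .
  next
    case False
    have "cmod (cinner (?T (Q l x)) (Q k y)) \<le> 2 * (\<tau> * (1/2) ^ l * (1/2) ^ k) * (norm (Q l x) * norm (Q k y))"
    proof (rule commutator_far_term[OF Qin Qin])
      fix u w assume u: "u \<in> cspan (e ` {n l..<n (Suc l)})" and w: "w \<in> cspan (e ` {n k..<n (Suc k)})"
      consider "l + 2 \<le> k" | "k + 2 \<le> l"
        using False unfolding adj_def by linarith
      then show "cmod (cinner (a u) w) \<le> \<tau> * (1/2) ^ l * (1/2) ^ k * norm u * norm w"
      proof cases
        case 1
        then show ?thesis
          using far[OF 1 u w] by blast
      next
        case 2
        then show ?thesis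
          using far[OF 2 w u] by (simp add: mult_ac)
      qed
    qed (use \<tau> in simp)
    also have "\<dots> \<le> 2 * (\<tau> * (1/2) ^ l * (1/2) ^ k) * (1 * 1)"
      using XY \<tau> unfolding X_def Y_def by (intro mult_left_mono mult_mono) auto
    finally show ?thesis
      using False by (simp add: mult_ac)
  qed
  have card_adj: "(\<Sum>k<K. if adj l k then c else 0) \<le> 3 * c" if "0 \<le> c" for l and c :: real
  proof -
    have "(\<Sum>k<K. if adj l k then c else 0) = (\<Sum>k\<in>{k. k < K \<and> adj l k}. c)"
      by (simp add: sum.If_cases Int_def)
    \<comment> \<open>For l = 0 truncated subtraction merges the first two elements, which only
      lowers the sum.\<close>
    also have "\<dots> \<le> (\<Sum>k\<in>{l - 1, l, Suc l}. c)"
      by (rule sum_mono2) (use that in \<open>auto simp: adj_def\<close>)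
    also have "\<dots> \<le> 3 * c"
      using that by (cases l) auto
    finally show ?thesis .
  qed
  have adj_sym: "adj l k = adj k l" for l k
    by (auto simp: adj_def)
  have sumX: "(\<Sum>l<K. \<Sum>k<K. if adj l k then (Z l)\<^sup>2 else 0) \<le> 3"
    if "(\<Sum>l<K. (Z l)\<^sup>2) \<le> 1" for Z :: "nat \<Rightarrow> real"
  proof -
    have "(\<Sum>l<K. \<Sum>k<K. if adj l k then (Z l)\<^sup>2 else 0) \<le> (\<Sum>l<K. 3 * (Z l)\<^sup>2)"
      by (intro sum_mono card_adj) simp
    also have "\<dots> = 3 * (\<Sum>l<K. (Z l)\<^sup>2)"
      by (rule sum_distrib_left[symmetric])
    finally show ?thesis
      using that by linarith
  qed
  have half: "(\<Sum>l<K. (1/2 :: real) ^ l) \<le> 2"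
    by (simp add: sum_gp_strict)
  have "cinner (?T x) y = cinner (?T (\<Sum>l<K. Q l x)) (\<Sum>k<K. Q k y)"
    by (simp only: Q[OF xy(1)] Q[OF xy(2)])
  also have "\<dots> = (\<Sum>l<K. \<Sum>k<K. cinner (?T (Q l x)) (Q k y))"
    by (simp only: blinfun.sum_right cinner.sum_left cinner.sum_right) (rule sum.swap)
  also have "cmod \<dots> \<le> (\<Sum>l<K. \<Sum>k<K. ?A l k + ?F l k)"
    by (intro sum_norm_le block_term)
  also have "\<dots> = (\<Sum>l<K. \<Sum>k<K. ?A l k) + (\<Sum>l<K. \<Sum>k<K. ?F l k)"
    by (simp add: sum.distrib)
  \<comment> \<open>Three neighbours for each of the two families of squares, and 2 for each
    geometric series: this yields the constants 9 and 8.\<close>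
  also have "\<dots> \<le> 3 * \<delta> * norm a / 2 * (3 + 3) + 2 * \<tau> * (2 * 2)"
  proof (rule add_mono)
    have "(\<Sum>l<K. \<Sum>k<K. ?A l k) = 3 * \<delta> * norm a / 2 *
        ((\<Sum>l<K. \<Sum>k<K. if adj l k then (X l)\<^sup>2 else 0) + (\<Sum>l<K. \<Sum>k<K. if adj l k then (Y k)\<^sup>2 else 0))"
      unfolding sum_distrib_left sum.distrib[symmetric] by (intro sum.cong refl) simp
    also have "(\<Sum>l<K. \<Sum>k<K. if adj l k then (Y k)\<^sup>2 else 0) = (\<Sum>k<K. \<Sum>l<K. if adj k l then (Y k)\<^sup>2 else 0)"
      by (subst sum.swap) (intro sum.cong refl, simp only: adj_sym)
    also have "3 * \<delta> * norm a / 2 * ((\<Sum>l<K. \<Sum>k<K. if adj l k then (X l)\<^sup>2 else 0) + \<dots>) \<le> 3 * \<delta> * norm a / 2 * (3 + 3)"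
      using nQ x y \<delta> unfolding X_def Y_def by (intro mult_left_mono add_mono sumX) auto
    finally show "(\<Sum>l<K. \<Sum>k<K. ?A l k) \<le> 3 * \<delta> * norm a / 2 * (3 + 3)" .
    have "(\<Sum>l<K. \<Sum>k<K. ?F l k) = 2 * \<tau> * ((\<Sum>l<K. (1/2) ^ l) * (\<Sum>k<K. (1/2) ^ k))"
      unfolding sum_product by (simp only: sum_distrib_left)
    also have "\<dots> \<le> 2 * \<tau> * (2 * 2)"
      using half \<tau> by (intro mult_left_mono mult_mono) (auto intro: sum_nonneg)
    finally show "(\<Sum>l<K. \<Sum>k<K. ?F l k) \<le> 2 * \<tau> * (2 * 2)" .
  qed
  finally show "cmod (cinner (?T x) y) \<le> 9 * \<delta> * norm a + 8 * \<tau>"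
    by simp
next
  show "complex_vector.subspace (cspan (range e))"
    by (rule complex_vector.subspace_span)
  show "0 \<le> 9 * \<delta> * norm a + 8 * \<tau>"
    using \<delta> \<tau> by simp
qed

end

section \<open>Pairs of adjacent blocks\<close>

text \<open>The orbit of this function at \<open>0\<close> consists of \<open>0\<close> and the odd iterates of \<open>f\<close>.\<close>

definition odd_shift :: "(nat \<Rightarrow> nat) \<Rightarrow> nat \<Rightarrow> nat" where
  "odd_shift f i = (if i = 0 then f 0 else f (f i))"

lemma strict_mono_odd_shift:
  assumes f: "strict_mono f" "\<And>m. m < f m"
  shows "strict_mono (odd_shift f)"
proof (rule strict_monoI)
  fix i j :: nat assume "i < j"
  moreover have "f 0 < f (f j)"
    using f(1) f(2)[of j] by (simp add: strict_mono_less)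
  ultimately show "odd_shift f i < odd_shift f j"
    using f(1) by (simp add: odd_shift_def strict_mono_less)
qed

text \<open>The iterate is \<open>Suc p\<close> because the zeroth point of the orbit is 0 and not
  an odd iterate of f. Positivity of the later points keeps them in the second branch of
  \<open>odd_shift\<close>.\<close>

lemma funpow_odd_shift:
  assumes f: "\<And>m. m < f m"
  shows "(odd_shift f ^^ Suc p) 0 = (f ^^ Suc (2 * p)) 0"
proof (induction p)
  case (Suc p)
  have "(f ^^ Suc (2 * p)) 0 > 0"
    using f[of "(f ^^ (2 * p)) 0"] by simp
  then have "odd_shift f ((f ^^ Suc (2 * p)) 0) = (f ^^ Suc (2 * Suc p)) 0"
    by (simp add: odd_shift_def)
  moreover have "(odd_shift f ^^ Suc (Suc p)) 0 = odd_shift f ((odd_shift f ^^ Suc p) 0)"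
    by simp
  ultimately show ?case
    by (simp only: Suc)
qed (simp add: odd_shift_def)

lemma funpow_twice: "((\<lambda>i. f (f i)) ^^ p) 0 = (f ^^ (2 * p)) (0 :: nat)"
  by (induction p) simp_all

text \<open>Blocks k and k + 1 of f together form one block of f composed with itself if k is even,
  and one block of \<open>odd_shift f\<close> if k is odd.\<close>

lemma adjacent_blocks_oscillation:
  assumes f: "\<And>m. m < f m" and x: "\<And>i. x i \<in> {0..1}"
    and ij: "(f ^^ k) 0 \<le> i" "i \<le> j" "j < (f ^^ (k + 2)) 0"
  shows "\<bar>x i - x j\<bar> \<le> max (oscillation (\<lambda>i. f (f i)) x) (oscillation (odd_shift f) x)"
proof (cases "even k")
  case True
  then obtain p where k: "k = 2 * p"
    by blast
  have "\<bar>x i - x j\<bar> \<le> oscillation (\<lambda>i. f (f i)) x"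
  proof (rule oscillation_upper[OF x _ ij(2)])
    show "((\<lambda>i. f (f i)) ^^ p) 0 \<le> i" "j < ((\<lambda>i. f (f i)) ^^ Suc p) 0"
      using ij unfolding funpow_twice k by simp_all
  qed
  then show ?thesis
    by simp
next
  case False
  then obtain p where k: "k = Suc (2 * p)"
    by (metis oddE Suc_eq_plus1)
  have "\<bar>x i - x j\<bar> \<le> oscillation (odd_shift f) x"
  proof (rule oscillation_upper[OF x _ ij(2)])
    show "(odd_shift f ^^ Suc p) 0 \<le> i" "j < (odd_shift f ^^ Suc (Suc p)) 0"
      using ij unfolding funpow_odd_shift[OF f] k by simp_all
  qed
  then show ?thesis
    by simp
qed

section \<open>A nontrivial commutant from a flatness scale\<close>

lemma diag_op_commutator_tendsto_0:
  fixes e :: "nat \<Rightarrow> 'h::chilbert_space" and a :: "'h \<Rightarrow>\<^sub>L 'h"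
  assumes e: "orthonormal e" and basis: "closure (cspan (range e)) = UNIV"
    and s: "flatness_scale \<alpha> s" and a: "clinear a"
  shows "((\<lambda>n. norm ((diag_op e (s n) o\<^sub>L a) - (a o\<^sub>L diag_op e (s n)))) \<longlongrightarrow> 0) \<alpha>"
proof (rule tendstoI)
  fix \<epsilon> :: real assume \<epsilon>: "\<epsilon> > 0"
  \<comment> \<open>Chosen so that 9 \<delta> \<open>norm a\<close> is at most \<epsilon> / 2 and 8
    \<tau> is \<epsilon> / 4; the added 1 in \<delta> covers a = 0.\<close>
  define \<tau> where "\<tau> = \<epsilon> / 32"
  define \<delta> where "\<delta> = \<epsilon> / 18 / (norm a + 1)"
  have \<tau>: "\<tau> > 0" and \<delta>: "\<delta> > 0"
    using \<epsilon> norm_ge_zero[of a] by (auto simp: \<tau>_def \<delta>_def intro!: divide_pos_pos mult_pos_pos add_nonneg_pos)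
  have s01: "s n i \<in> {0..1}" for n i
    using s by (simp add: flatness_scale_def)
  \<comment> \<open>This f depends on a and \<tau> alone and serves all members of the scale at
    once, so flatness may be applied to functions built from it.\<close>
  obtain f where f: "strict_mono f" "\<And>m. m < f m"
    and far: "\<And>m u w. u \<in> cspan (e ` {..<m}) \<Longrightarrow> w \<in> cspan (e ` {f m..}) \<Longrightarrow>
      cmod (cinner (a u) w) \<le> \<tau> * (1/4) ^ Suc m * norm u * norm w \<and>
      cmod (cinner (a w) u) \<le> \<tau> * (1/4) ^ Suc m * norm u * norm w"
    using ex_block_function[OF e a \<tau>] by blast
  define n where "n k = (f ^^ k) 0" for k
  have n: "strict_mono n" "n 0 = 0"
    using f(2) by (auto simp: strict_mono_Suc_iff n_def)
  have "eventually (\<lambda>m. oscillation g (s m) < \<delta>) \<alpha>" if "strict_mono g" for g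
    using s that \<delta> by (intro order_tendstoD) (auto simp: flatness_scale_def)
  moreover have "strict_mono (\<lambda>i. f (f i))"
    using f(1) by (simp add: strict_mono_def)
  ultimately have "eventually (\<lambda>m. oscillation (\<lambda>i. f (f i)) (s m) < \<delta> \<and> oscillation (odd_shift f) (s m) < \<delta>) \<alpha>"
    using strict_mono_odd_shift[OF f] by (intro eventually_conj) auto
  then show "eventually (\<lambda>m. dist (norm ((diag_op e (s m) o\<^sub>L a) - (a o\<^sub>L diag_op e (s m)))) 0 < \<epsilon>) \<alpha>"
  proof eventually_elim
    case (elim m)
    have "norm ((diag_op e (s m) o\<^sub>L a) - (a o\<^sub>L diag_op e (s m))) \<le> 9 * \<delta> * norm a + 8 * \<tau>"
    proof (rule norm_commutator_diag_op_le[OF e s01[of m] basis a n])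
      fix k i j assume "n k \<le> i" "i \<le> j" "j < n (k + 2)"
      then show "\<bar>s m i - s m j\<bar> \<le> \<delta>"
        using adjacent_blocks_oscillation[of f "s m" k i j, OF f(2) s01] elim
        unfolding n_def by linarith
    next
      fix k l u w
      assume kl: "k + 2 \<le> l" and u: "u \<in> cspan (e ` {n k..<n (Suc k)})" and w: "w \<in> cspan (e ` {n l..<n (Suc l)})"
      \<comment> \<open>Block k lies below n l', and block l starts at f (n l'), so the pair is
        governed by the bound for m = n l'.\<close>
      obtain l' where l': "l = Suc l'"
        using kl by (cases l) auto
      have "n (Suc k) \<le> n l'"
        using kl l' n(1) by (simp add: strict_mono_less_eq)
      then have "{n k..<n (Suc k)} \<subseteq> {..<n l'}"
        by auto
      then have u': "u \<in> cspan (e ` {..<n l'})"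
        using u complex_vector.span_mono[OF image_mono, of "{n k..<n (Suc k)}" "{..<n l'}" e] by auto
      have w': "w \<in> cspan (e ` {f (n l')..})"
        by (rule subsetD[OF complex_vector.span_mono[OF image_mono] w]) (auto simp: n_def l')
      have "l' \<le> n l'"
        using n(1) by (rule strict_mono_imp_increasing)
      \<comment> \<open>This is the reason for the base 1/4: it splits into two factors 1/2 to the
        power l, and one of them is given up to the smaller exponent k.\<close>
      then have "(1/4 :: real) ^ Suc (n l') \<le> (1/4) ^ l"
        unfolding l' by (intro power_decreasing) auto
      also have "\<dots> = (1/2) ^ l * (1/2) ^ l"
        by (simp add: power_mult_distrib[symmetric])
      also have "\<dots> \<le> (1/2) ^ k * (1/2) ^ l"
        using kl by (intro mult_right_mono power_decreasing) auto
      finally have "\<tau> * (1/4) ^ Suc (n l') * norm u * norm w \<le> \<tau> * ((1/2) ^ k * (1/2) ^ l) * norm u * norm w"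
        using \<tau> by (intro mult_right_mono mult_left_mono) auto
      then show "cmod (cinner (a u) w) \<le> \<tau> * (1/2) ^ k * (1/2) ^ l * norm u * norm w \<and>
          cmod (cinner (a w) u) \<le> \<tau> * (1/2) ^ k * (1/2) ^ l * norm u * norm w"
        using far[OF u' w'] unfolding mult.assoc by linarith
    qed (use \<tau> \<delta> in auto)
    also have "9 * \<delta> * norm a \<le> \<epsilon> / 2"
    proof -
      have "\<delta> * norm a \<le> \<delta> * (norm a + 1)"
        using \<delta> by simp
      also have "\<dots> = \<epsilon> / 18"
      proof (rule nonzero_eq_divide_eq[THEN iffD1])
        show "norm a + 1 \<noteq> 0"
          using norm_ge_zero[of a] by linarith
      qed (rule \<delta>_def)
      finally show ?thesis
        by simp
    qed
    then have "9 * \<delta> * norm a + 8 * \<tau> < \<epsilon>"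
      using \<epsilon> by (simp add: \<tau>_def)
    finally show ?case
      by simp
  qed
qed

text \<open>All entries of \<open>s n\<close> lie within the norm of the difference from c. Since
  they tend to 0, so does c lie within that norm of 0, and no entry can exceed twice the norm; with
  norm below r / 4 the supremum could not reach r.\<close>

lemma diag_op_nonscalar:
  fixes e :: "nat \<Rightarrow> 'h::chilbert_space"
  assumes e: "orthonormal e" and s: "flatness_scale \<alpha> s" and \<alpha>: "\<alpha> \<noteq> bot"
  shows "\<not> ((\<lambda>n. norm (diag_op e (s n) - scaleC_blinfun c id_blinfun)) \<longlongrightarrow> 0) \<alpha>"
proof
  assume lim: "((\<lambda>n. norm (diag_op e (s n) - scaleC_blinfun c id_blinfun)) \<longlongrightarrow> 0) \<alpha>"
  have s01: "s n i \<in> {0..1}" for n i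
    using s by (simp add: flatness_scale_def)
  obtain r where r: "r > 0" "\<And>n. (SUP i. s n i) \<ge> r" "\<And>n. s n \<longlonglongrightarrow> 0"
    using s by (auto simp: flatness_scale_def)
  have "eventually (\<lambda>n. norm (diag_op e (s n) - scaleC_blinfun c id_blinfun) < r / 4) \<alpha>"
    using lim r(1) by (intro order_tendstoD) auto
  then obtain n where n: "norm (diag_op e (s n) - scaleC_blinfun c id_blinfun) < r / 4" (is "norm ?D < _")
    using eventually_happens' \<alpha> by blast
  have le: "cmod (complex_of_real (s n i) - c) \<le> norm ?D" for i
  proof -
    have "?D (e i) = (complex_of_real (s n i) - c) *\<^sub>C e i"
      by (simp add: blinfun.diff_left scaleC_blinfun.rep_eq diag_op_basis[OF e s01[of n]]
          complex_vector.scale_left_diff_distrib)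
    then show ?thesis
      using norm_blinfun[of ?D "e i"] by (simp add: norm_scaleC orthonormal_norm[OF e])
  qed
  have "(\<lambda>i. cmod (complex_of_real (s n i) - c)) \<longlonglongrightarrow> cmod (complex_of_real 0 - c)"
    by (intro tendsto_intros r)
  then have c: "cmod c \<le> norm ?D"
    using le by (intro LIMSEQ_le_const2[of "\<lambda>i. cmod (complex_of_real (s n i) - c)"]) auto
  have "r / 2 < (SUP i. s n i)"
    using r(1) r(2)[of n] by linarith
  then obtain i where "r / 2 < s n i"
    using s01 by (subst (asm) less_cSUP_iff) (auto intro: bdd_aboveI2[of _ _ 1])
  also have "s n i \<le> cmod (complex_of_real (s n i))"
    by simp
  also have "\<dots> \<le> cmod (complex_of_real (s n i) - c) + cmod c"
    using norm_triangle_ineq[of "complex_of_real (s n i) - c" c] by simp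
  also have "\<dots> \<le> norm ?D + norm ?D"
    using le c by (rule add_mono)
  finally show False
    using n by simp
qed

theorem theorem25:
  fixes \<alpha> :: "nat filter"
  assumes separable: "separable_space (euclidean :: 'h::chilbert_space topology)"
    and infinite_dimensional: "\<not> (\<exists>B :: 'h set. finite B \<and> cspan B = UNIV)"
    and nonprincipal: "nonprincipal_ultrafilter \<alpha>"
  shows "ultrapower_commutant \<alpha> (bounded_operators :: (complex, 'h \<Rightarrow>\<^sub>L 'h) module)
      \<noteq> ultrapower_scalars \<alpha> (bounded_operators :: (complex, 'h \<Rightarrow>\<^sub>L 'h) module)
    \<longleftrightarrow> flat \<alpha>"
proof -
  obtain e :: "nat \<Rightarrow> 'h" where e: "orthonormal e" and basis: "closure (cspan (range e)) = UNIV"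
    using ex_orthonormal_basis[OF separable infinite_dimensional] by blast
  show ?thesis
    unfolding commutant_nontrivial_iff
  proof
    assume "\<exists>x :: nat \<Rightarrow> 'h \<Rightarrow>\<^sub>L 'h. (\<forall>n. clinear (x n)) \<and> bounded (range x) \<and>
      (\<forall>a. clinear a \<longrightarrow> ((\<lambda>n. norm ((x n o\<^sub>L a) - (a o\<^sub>L x n))) \<longlongrightarrow> 0) \<alpha>) \<and>
      \<not> (\<exists>c. ((\<lambda>n. norm (x n - scaleC_blinfun c id_blinfun)) \<longlongrightarrow> 0) \<alpha>)"
    then show "flat \<alpha>"
      using flat_if_commutant_nontrivial[OF nonprincipal e basis] by blast
  next
    assume "flat \<alpha>"
    then obtain s where s: "flatness_scale \<alpha> s"
      by (auto simp: flat_def)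
    then have s01: "s n i \<in> {0..1}" for n i
      by (simp add: flatness_scale_def)
    let ?x = "\<lambda>n. diag_op e (s n)"
    have "norm (?x n) \<le> 1" and cl: "clinear (?x n)" for n
      by (rule norm_diag_op[OF e s01[of n]], rule clinear_diag_op[OF e s01[of n]])
    then have "bounded (range ?x)"
      by (auto simp: bounded_iff)
    moreover have "\<alpha> \<noteq> bot"
      using nonprincipal by (simp add: nonprincipal_ultrafilter_def)
    ultimately show "\<exists>x :: nat \<Rightarrow> 'h \<Rightarrow>\<^sub>L 'h. (\<forall>n. clinear (x n)) \<and> bounded (range x) \<and>
      (\<forall>a. clinear a \<longrightarrow> ((\<lambda>n. norm ((x n o\<^sub>L a) - (a o\<^sub>L x n))) \<longlongrightarrow> 0) \<alpha>) \<and>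
      \<not> (\<exists>c. ((\<lambda>n. norm (x n - scaleC_blinfun c id_blinfun)) \<longlongrightarrow> 0) \<alpha>)"
      using cl diag_op_commutator_tendsto_0[OF e basis s] diag_op_nonscalar[OF e s]
      by (intro exI[of _ ?x]) blast
  qed
qed

end
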